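(* There exists an absolute constant $C>0$ such that for every integer $n\geq 1$ and all $\varepsilon,\delta\in(0,1)$ there is a random $n\times n$ real matrix $R$, which can be generated (i.e. is a deterministic function of) at most $C\,n\log(n)\,\delta^{-C}$ independent uniformly random bits, such that $R$ is a $(\kappa,\varepsilon,\delta)$-well-conditioned oblivious perturbation with $\kappa\leq C\,n\,(\varepsilon\delta)^{-C}$.
   Context: For a matrix $M$, $\|M\|$ denotes the spectral (operator) norm and $\kappa(M)=\|M\|\,\|M^{-1}\|$ its condition number ($\kappa(M)=\infty$ if $M$ is singular). An $n\times n$ random matrix $R$ is a $(\kappa,\varepsilon,\delta)$-well-conditioned oblivious perturbation if for every deterministic matrix $A\in\mathbb{R}^{n\times n}$ with $\|A\|=1$ we have $\mathbb{P}\big(\kappa(A+\varepsilon R)\leq \kappa \text{ and } \|R\|\leq 1\big)\geq 1-\delta$. The statement's "$n\log(n)\cdot\mathrm{poly}(1/\delta)$ random bits" and "$\kappa=n\cdot\mathrm{poly}(1/\varepsilon\delta)$" are rendered with a single absolute constant $C$. *)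

theory Defs
  imports "HOL-Probability.Probability" "Jordan_Normal_Form.Gauss_Jordan_Elimination"
begin

text \<open>
  Matrices are those of Jordan_Normal_Form, whose dimension is a term and not a type: a constant
  can then be chosen uniformly in the dimension.
\<close>

definition euclidean_norm :: "real Matrix.vec \<Rightarrow> real" where
  "euclidean_norm v = sqrt (v \<bullet> v)"

definition spectral_norm :: "real mat \<Rightarrow> real" where
  "spectral_norm M =
     (SUP v \<in> {v \<in> carrier_vec (dim_col M). euclidean_norm v \<le> 1}. euclidean_norm (M *\<^sub>v v))"

definition condition_number :: "real mat \<Rightarrow> ereal" where
  "condition_number M =
     (case mat_inverse M of
        None \<Rightarrow> \<infinity>
      | Some M' \<Rightarrow> ereal (spectral_norm M * spectral_norm M'))"

definition random_matrix :: "'w measure \<Rightarrow> nat \<Rightarrow> ('w \<Rightarrow> real mat) \<Rightarrow> bool" where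
  "random_matrix P n R \<longleftrightarrow>
     prob_space P \<and>
     (\<forall>\<omega>\<in>space P. R \<omega> \<in> carrier_mat n n) \<and>
     (\<forall>i<n. \<forall>j<n. (\<lambda>\<omega>. R \<omega> $$ (i, j)) \<in> borel_measurable P)"

definition well_conditioned_oblivious_perturbation ::
  "'w measure \<Rightarrow> nat \<Rightarrow> ('w \<Rightarrow> real mat) \<Rightarrow> real \<Rightarrow> real \<Rightarrow> real \<Rightarrow> bool" where
  "well_conditioned_oblivious_perturbation P n R \<kappa> \<epsilon> \<delta> \<longleftrightarrow>
     random_matrix P n R \<and>
     (\<forall>A \<in> carrier_mat n n. spectral_norm A = 1 \<longrightarrow>
        measure P {\<omega> \<in> space P. condition_number (A + \<epsilon> \<cdot>\<^sub>m R \<omega>) \<le> ereal \<kappa> \<and>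
                                spectral_norm (R \<omega>) \<le> 1} \<ge> 1 - \<delta>)"

text \<open>
  The bits are indexed by \<open>{..<m}\<close>; all other values of the function are \<open>False\<close> almost surely, so
  a function on this space is a deterministic function of \<open>m\<close> bits.
\<close>

definition random_bits :: "nat \<Rightarrow> (nat \<Rightarrow> bool) measure" where
  "random_bits m = measure_pmf (Pi_pmf {..<m} False (\<lambda>_. bernoulli_pmf (1/2)))"

end

theory Submission
  imports Defs "Jordan_Normal_Form.Determinant"
begin

text \<open>
  Call a family of vectors a robust frame if its operator norm is that of a tight frame up to a
  constant, while for every unit vector \<open>w\<close> only a small fraction of the family has an inner product
  with \<open>w\<close> below \<open>c\<close> times the typical size. Robust frames of \<open>O(n)\<close> vectors exist: on a net of the
  sphere, a greedy choice keeps an exponential potential small, because a Gaussian vector does so on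
  average.

  Fix robust frames \<open>(u\<^sub>k)\<close> with \<open>k < K = O(n)\<close> and \<open>(g\<^sub>l)\<close> with \<open>l < Q = n poly(1/\<delta>)\<close>, \<open>Q\<close> a power of two.
  Draw \<open>x\<^sub>k < Q\<close> independently, which takes \<open>K log Q\<close> bits, and let \<open>R\<close> be the sum of the rank-one matrices
  \<open>g\<^bsub>x\<^sub>k\<^esub> u\<^sub>k\<^sup>T\<close> over the indices \<open>k\<close> whose \<open>x\<^sub>k\<close> is not drawn twice. Given all \<open>x\<^sub>j\<close> with
  \<open>j \<noteq> k\<close>, the remaining matrix \<open>M'\<close> has a unit vector \<open>w\<close> with \<open>M'\<^sup>T w = a u\<^sub>k\<close>, so for \<open>M = A + \<epsilon> R\<close>
  the value \<open>\<langle>w, M v\<rangle> = (a + \<epsilon> \<langle>g\<^bsub>x\<^sub>k\<^esub>, w\<rangle>) \<langle>u\<^sub>k, v\<rangle>\<close> bounds \<open>|M v|\<close> from below. The first factor is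
  large for most \<open>x\<^sub>k\<close> by robustness of \<open>g\<close>, hence for most \<open>k\<close> with probability \<open>1 - \<delta>\<close>; by robustness
  of \<open>u\<close> every unit \<open>v\<close> then has an index \<open>k\<close> for which both factors are large.
\<close>

section \<open>Gaussian vectors\<close>

text \<open>The coordinates are independent, so their weighted sum is normal and the variances add
  up. No weight may vanish, because each summand must have a normal density of its own.\<close>

lemma sum_normal_distributed:
  fixes w :: "nat \<Rightarrow> real"
  assumes n: "n > 0" and w: "\<And>i. i < n \<Longrightarrow> w i \<noteq> 0"
  defines "M \<equiv> PiM {..<n} (\<lambda>_. density lborel std_normal_density)"
  shows "distributed M lborel (\<lambda>f. \<Sum>i<n. f i * w i) (normal_density 0 (sqrt (\<Sum>i<n. (w i)\<^sup>2)))"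
proof -
  let ?N = "density lborel std_normal_density"
  interpret N: prob_space ?N by (rule prob_space_normal_density) simp
  interpret P: product_prob_space "\<lambda>_. ?N" "{..<n}" by unfold_locales
  interpret prob_space M unfolding M_def by unfold_locales
  have comp: "distr M ?N (\<lambda>f. f i) = ?N" if "i < n" for i
    unfolding M_def using P.PiM_component[of i] that by simp
  have meas: "(\<lambda>f. f i) \<in> measurable M ?N" if "i < n" for i
    unfolding M_def using that by simp
  have distr1: "distributed M lborel (\<lambda>f. f i) std_normal_density" if "i < n" for i
    unfolding distributed_def
  proof (intro conjI)
    show "distr M lborel (\<lambda>f. f i) = ?N"
      using comp[OF that] by (metis distr_cong sets_density)
    show "(\<lambda>f. f i) \<in> measurable M lborel" using meas[OF that] by simp
    show "(\<lambda>x. ennreal (std_normal_density x)) \<in> borel_measurable lborel" by simp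
  qed
  have indep: "indep_vars (\<lambda>_. ?N) (\<lambda>i f. f i) {..<n}"
  proof (subst indep_vars_iff_distr_eq_PiM')
    show "{..<n} \<noteq> {}" using n by auto
    show "random_variable ?N (\<lambda>f. f i)" if "i \<in> {..<n}" for i using meas that by simp
    have "distr M (PiM {..<n} (\<lambda>_. ?N)) (\<lambda>f. \<lambda>i\<in>{..<n}. f i) = distr M M (\<lambda>f. f)"
      by (rule distr_cong) (auto simp: M_def space_PiM PiE_def extensional_restrict)
    also have "\<dots> = M" by simp
    also have "\<dots> = PiM {..<n} (\<lambda>i. distr M ?N (\<lambda>f. f i))"
      by (subst M_def, rule PiM_cong) (auto simp: comp)
    finally show "distr M (PiM {..<n} (\<lambda>_. ?N)) (\<lambda>f. \<lambda>i\<in>{..<n}. f i)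
       = PiM {..<n} (\<lambda>i. distr M ?N (\<lambda>f. f i))" .
  qed
  have indep2: "indep_vars (\<lambda>_. borel) (\<lambda>i f. 0 + w i * f i) {..<n}"
    using indep_vars_compose2[OF indep, of "\<lambda>i x. 0 + w i * x" "\<lambda>_. borel"] by simp
  have d2: "distributed M lborel (\<lambda>f. 0 + w i * f i) (normal_density (0 + w i * 0) (\<bar>w i\<bar> * 1))"
    if "i < n" for i
    by (rule normal_density_affine[OF distr1[OF that]]) (use w that in auto)
  have "distributed M lborel (\<lambda>f. \<Sum>i<n. 0 + w i * f i)
     (normal_density (\<Sum>i<n. (0::real)) (sqrt (\<Sum>i<n. \<bar>w i\<bar>\<^sup>2)))"
    by (rule sum_indep_normal[OF _ _ indep2]) (use d2 w n in auto)
  then show ?thesis by (simp add: mult.commute)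
qed

text \<open>The factor \<open>exp (\<delta>/256 * x\<^sup>2)\<close> turns the density into
  \<open>s'/s\<close> times a wider normal density, which costs at most \<open>\<delta>/16\<close>.
  The indicator acts only on an interval of length \<open>\<delta>/16\<close>, where the density is
  at most 1, and adds at most 3 times that length.\<close>

lemma normal_exp_moment:
  fixes s \<delta> :: real
  assumes s: "1/2 \<le> s" "s \<le> 2" and \<delta>: "0 < \<delta>" "\<delta> \<le> 1"
  defines "\<phi> \<equiv> \<lambda>x. (if \<bar>x\<bar> < \<delta>/32 then 1 else 0) + \<delta>/256 * x\<^sup>2"
  shows "integrable lborel (\<lambda>x. normal_density 0 s x * exp (\<phi> x))" (is ?I)
    and "(\<integral>x. normal_density 0 s x * exp (\<phi> x) \<partial>lborel) \<le> 1 + \<delta>/4" (is ?L)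
proof -
  \<comment> \<open>Completing the exponent gives
    \<open>1/(2*s\<^sup>2) - \<delta>/256 = (1-y)/(2*s\<^sup>2)\<close>, so the tilted density is a
    multiple of the normal one with variance \<open>s\<^sup>2/(1-y)\<close>.\<close>
  define y where "y = \<delta>/128 * s\<^sup>2"
  define s' where "s' = s / sqrt (1 - y)"
  have "s\<^sup>2 \<le> 2\<^sup>2" using s by (intro power_mono) auto
  then have y: "0 < y" "y \<le> \<delta>/32" using s \<delta> by (auto simp: y_def)
  have s'pos: "s' > 0" using s y \<delta> by (simp add: s'_def)
  have tilt: "normal_density 0 s x * exp (\<delta>/256 * x\<^sup>2) = (s'/s) * normal_density 0 s' x" for x
  proof -
    have s2: "s'\<^sup>2 = s\<^sup>2 / (1 - y)" using y \<delta> by (simp add: s'_def power_divide)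
    have "- x\<^sup>2 / (2 * s\<^sup>2) + \<delta>/256 * x\<^sup>2 = - x\<^sup>2 / (2 * s'\<^sup>2)"
      unfolding s2 using y \<delta> s by (simp add: y_def field_simps)
    then have "exp (- x\<^sup>2 / (2 * s\<^sup>2)) * exp (\<delta>/256 * x\<^sup>2) = exp (- x\<^sup>2 / (2 * s'\<^sup>2))"
      by (simp add: exp_add[symmetric])
    then show ?thesis using s s'pos
      by (simp add: normal_density_def real_sqrt_mult field_simps)
  qed
  define g where "g = (\<lambda>x. (s'/s) * normal_density 0 s' x + 3 * (indicator {-(\<delta>/32)..\<delta>/32} x :: real))"
  have ig: "integrable lborel g" unfolding g_def
    by (intro Bochner_Integration.integrable_add integrable_mult_right integrable_normal_density s'pos integrable_real_indicator)
       (auto simp: emeasure_lborel_Icc_eq)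
  have dens: "normal_density 0 s x \<le> 1" for x
  proof -
    have "2 \<le> sqrt (2 * pi)" using pi_gt3 by (intro real_le_rsqrt) auto
    then have "2 * (1/2) \<le> sqrt (2*pi) * s" using s by (intro mult_mono) auto
    then have "1 / sqrt (2 * pi * s\<^sup>2) \<le> 1" using s by (simp add: real_sqrt_mult)
    moreover have "exp (- x\<^sup>2 / (2 * s\<^sup>2)) \<le> 1" by simp
    ultimately show ?thesis unfolding normal_density_def
      using mult_mono[of "1 / sqrt (2 * pi * s\<^sup>2)" 1 "exp (- x\<^sup>2 / (2 * s\<^sup>2))" 1] by simp
  qed
  have le: "normal_density 0 s x * exp (\<phi> x) \<le> g x" for x
  proof (cases "\<bar>x\<bar> < \<delta>/32")
    case True
    have "x\<^sup>2 \<le> 1" using True \<delta> by (simp add: abs_square_le_1)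
    then have "\<delta>/256 * x\<^sup>2 \<le> 1/256 * 1" using \<delta> by (intro mult_mono) auto
    then have "\<delta>/256 * x\<^sup>2 \<le> 1/256" by simp
    moreover have "0 \<le> \<delta>/256 * x\<^sup>2" using \<delta> by simp
    ultimately have e: "exp (\<delta>/256 * x\<^sup>2) \<le> 3/2"
      using exp_bound_lemma[of "\<delta>/256 * x\<^sup>2"] by simp
    have "exp (\<phi> x) = exp 1 * exp (\<delta>/256 * x\<^sup>2)" using True by (simp add: \<phi>_def exp_add)
    also have "\<dots> \<le> 3 * exp (\<delta>/256 * x\<^sup>2)" using exp_le by (intro mult_right_mono) auto
    also have "\<dots> \<le> exp (\<delta>/256 * x\<^sup>2) + 3" using e by simp
    finally have "normal_density 0 s x * exp (\<phi> x) \<le> normal_density 0 s x * (exp (\<delta>/256 * x\<^sup>2) + 3)"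
      by (intro mult_left_mono) auto
    also have "\<dots> \<le> g x"
    proof -
      have "(indicator {-(\<delta>/32)..\<delta>/32} x :: real) = 1" using True by (auto simp: indicator_def)
      then show ?thesis using dens[of x] tilt[of x] by (simp add: g_def distrib_left)
    qed
    finally show ?thesis .
  next
    case False
    then show ?thesis using tilt[of x] by (auto simp: g_def \<phi>_def indicator_def)
  qed
  have meas: "(\<lambda>x. normal_density 0 s x * exp (\<phi> x)) \<in> borel_measurable lborel"
    unfolding \<phi>_def by measurable
  show I: ?I
    by (rule Bochner_Integration.integrable_bound[OF ig meas]) 
       (use le in \<open>auto simp: abs_mult intro: order_trans[OF le abs_ge_self]\<close>)
  have "(\<integral>x. normal_density 0 s x * exp (\<phi> x) \<partial>lborel) \<le> (\<integral>x. g x \<partial>lborel)"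
    by (rule integral_mono[OF I ig le])
  also have "\<dots> = s'/s + 3 * (\<delta>/16)" unfolding g_def
    using s'pos \<delta> by (subst Bochner_Integration.integral_add) auto
  also have "s'/s \<le> 1 + \<delta>/16"
  proof -
    have "1 - y \<le> sqrt (1 - y)" using y \<delta> by (intro real_le_rsqrt) (auto simp: power2_eq_square mult_left_le)
    then have "s'/s \<le> 1 / (1 - y)" using s y \<delta> by (simp add: s'_def field_simps)
    also have "\<dots> \<le> 1 + 2*y" using y \<delta> by (simp add: field_simps power2_eq_square) 
    finally show ?thesis using y by simp
  qed
  finally show ?L by simp
qed

section \<open>Robust frames\<close>

text \<open>In the estimates a vector is a function of which only the first \<open>n\<close> values
  count. This form fits the product measure on \<open>{..<n}\<close> and avoids carrier conditions;
  \<open>euclidean_norm_dot\<close> and \<open>euclidean_norm_mult_mat_vec\<close> translate to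
  matrices.\<close>

definition dot :: "nat \<Rightarrow> (nat \<Rightarrow> real) \<Rightarrow> (nat \<Rightarrow> real) \<Rightarrow> real" where
  "dot n f w = (\<Sum>i<n. f i * w i)"

lemma dot_cong: "(\<And>i. i < n \<Longrightarrow> f i = f' i) \<Longrightarrow> (\<And>i. i < n \<Longrightarrow> g i = g' i) \<Longrightarrow> dot n f g = dot n f' g'"
  by (simp add: dot_def)

lemma dot_scale: "dot n (\<lambda>i. c * f i) g = c * dot n f g"
  by (simp add: dot_def sum_distrib_left mult.assoc)

lemma dot_Cauchy_Schwarz: "(dot n f g)\<^sup>2 \<le> dot n f f * dot n g g"
  unfolding dot_def using Cauchy_Schwarz_ineq_sum[of f g "{..<n}"] by (simp add: power2_eq_square)

lemma dot_self_nonneg: "0 \<le> dot n f f"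
  unfolding dot_def by (intro sum_nonneg) auto

lemma dot_triangle: "sqrt (dot n (\<lambda>i. f i + g i) (\<lambda>i. f i + g i)) \<le> sqrt (dot n f f) + sqrt (dot n g g)"
  using L2_set_triangle_ineq[of f g "{..<n}"] by (simp add: dot_def L2_set_def power2_eq_square)

text \<open>
  The indicator counts small inner products and the quadratic term controls the operator norm of the
  frame; both fit in one exponential moment, so one greedy selection serves both purposes.
\<close>

definition potential :: "real \<Rightarrow> real \<Rightarrow> real" where
  "potential \<delta> x = (if \<bar>x\<bar> < \<delta>/32 then 1 else 0) + \<delta>/256 * x\<^sup>2"

text \<open>A standard Gaussian vector satisfies the bound on average, so some vector satisfies it.
  The weights \<open>b\<close> stand for the potential that earlier vectors have accumulated at each
  \<open>w\<close>.\<close>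

lemma exists_vector_small_potential:
  fixes T :: "(nat \<Rightarrow> real) set" and b :: "(nat \<Rightarrow> real) \<Rightarrow> real"
  assumes n: "n > 0" and \<delta>: "0 < \<delta>" "\<delta> \<le> 1" and T: "finite T"
    and nz: "\<And>w i. w \<in> T \<Longrightarrow> i < n \<Longrightarrow> w i \<noteq> 0"
    and norm: "\<And>w. w \<in> T \<Longrightarrow> 1/4 \<le> dot n w w \<and> dot n w w \<le> 4"
    and b: "\<And>w. w \<in> T \<Longrightarrow> b w \<ge> 0"
  shows "\<exists>f. (\<Sum>w\<in>T. b w * exp (potential \<delta> (dot n f w))) \<le> exp (\<delta>/4) * (\<Sum>w\<in>T. b w)"
proof -
  define M where "M = PiM {..<n} (\<lambda>_. density lborel std_normal_density)"
  interpret N: prob_space "density lborel std_normal_density" by (rule prob_space_normal_density) simp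
  interpret P: product_prob_space "\<lambda>_. density lborel std_normal_density" "{..<n}" by unfold_locales
  interpret prob_space M unfolding M_def by unfold_locales
  have *: "integrable M (\<lambda>f. exp (potential \<delta> (dot n f w))) \<and>
      (\<integral>f. exp (potential \<delta> (dot n f w)) \<partial>M) \<le> 1 + \<delta>/4" if w: "w \<in> T" for w
  proof -
    define s where "s = sqrt (\<Sum>i<n. (w i)\<^sup>2)"
    have "s = sqrt (dot n w w)" by (simp add: s_def dot_def power2_eq_square)
    then have s: "1/2 \<le> s" "s \<le> 2"
      using norm[OF w] real_le_rsqrt[of "1/2" "dot n w w"] real_sqrt_le_mono[of "dot n w w" 4]
      by (auto simp: power2_eq_square)
    have D: "distributed M lborel (\<lambda>f. dot n f w) (normal_density 0 s)"
      unfolding M_def s_def dot_def by (rule sum_normal_distributed[OF n nz[OF w]])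
    have m: "(\<lambda>x. exp (potential \<delta> x)) \<in> borel_measurable lborel"
      unfolding potential_def by measurable
    show ?thesis
      using normal_exp_moment[OF s \<delta>] distributed_integrable[OF D m] distributed_integral[OF D m]
      by (simp add: potential_def)
  qed
  define \<Phi> where "\<Phi> = (\<lambda>f. \<Sum>w\<in>T. b w * exp (potential \<delta> (dot n f w)))"
  have int: "integrable M \<Phi>" unfolding \<Phi>_def using * by auto
  have "(\<integral>f. \<Phi> f \<partial>M) = (\<Sum>w\<in>T. b w * (\<integral>f. exp (potential \<delta> (dot n f w)) \<partial>M))"
    unfolding \<Phi>_def using * by (subst Bochner_Integration.integral_sum) auto
  also have "\<dots> \<le> (\<Sum>w\<in>T. b w * exp (\<delta>/4))"
    using b by (intro sum_mono mult_left_mono order_trans[OF conjunct2[OF *] exp_ge_add_one_self]) auto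
  finally have le: "(\<integral>f. \<Phi> f \<partial>M) \<le> exp (\<delta>/4) * (\<Sum>w\<in>T. b w)"
    by (simp add: sum_distrib_right mult.commute)
  show ?thesis
  proof (rule ccontr)
    assume "\<not> ?thesis"
    then have "\<And>f. exp (\<delta>/4) * (\<Sum>w\<in>T. b w) < \<Phi> f" by (auto simp: \<Phi>_def not_le)
    then have "exp (\<delta>/4) * (\<Sum>w\<in>T. b w) < (\<integral>f. \<Phi> f \<partial>M)"
      using integral_less_AE_space[of "\<lambda>_. exp (\<delta>/4) * (\<Sum>w\<in>T. b w)" \<Phi>] int
      by (auto simp: prob_space emeasure_space_1)
    with le show False by simp
  qed
qed

text \<open>Greedy choice: each new vector multiplies the total by at most
  \<open>exp (\<delta>/4)\<close>, the exponentials of the sums so far serving as weights.\<close>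

lemma exists_vectors_small_potential:
  fixes T :: "(nat \<Rightarrow> real) set" and N :: nat
  assumes n: "n > 0" and \<delta>: "0 < \<delta>" "\<delta> \<le> 1" and T: "finite T"
    and nz: "\<And>w i. w \<in> T \<Longrightarrow> i < n \<Longrightarrow> w i \<noteq> 0"
    and norm: "\<And>w. w \<in> T \<Longrightarrow> 1/4 \<le> dot n w w \<and> dot n w w \<le> 4"
  shows "\<exists>f. (\<Sum>w\<in>T. exp (\<Sum>k<N. potential \<delta> (dot n (f k) w))) \<le> exp (\<delta>/4 * N) * card T"
proof (induction N)
  case 0
  then show ?case by simp
next
  case (Suc N)
  then obtain f where f: "(\<Sum>w\<in>T. exp (\<Sum>k<N. potential \<delta> (dot n (f k) w))) \<le> exp (\<delta>/4 * N) * card T"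
    by blast
  obtain g where g: "(\<Sum>w\<in>T. exp (\<Sum>k<N. potential \<delta> (dot n (f k) w)) * exp (potential \<delta> (dot n g w)))
     \<le> exp (\<delta>/4) * (\<Sum>w\<in>T. exp (\<Sum>k<N. potential \<delta> (dot n (f k) w)))"
    using exists_vector_small_potential[of n \<delta> T "\<lambda>w. exp (\<Sum>k<N. potential \<delta> (dot n (f k) w))"]
      n \<delta> T nz norm by auto
  define f' where "f' = f(N := g)"
  have "(\<Sum>w\<in>T. exp (\<Sum>k<Suc N. potential \<delta> (dot n (f' k) w)))
     = (\<Sum>w\<in>T. exp (\<Sum>k<N. potential \<delta> (dot n (f k) w)) * exp (potential \<delta> (dot n g w)))"
    by (simp add: exp_add f'_def)
  also note g
  also have "exp (\<delta>/4) * (\<Sum>w\<in>T. exp (\<Sum>k<N. potential \<delta> (dot n (f k) w)))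
     \<le> exp (\<delta>/4) * (exp (\<delta>/4 * N) * card T)"
    using f by (intro mult_left_mono) auto
  also have "\<dots> = exp (\<delta>/4 * Suc N) * card T" by (simp add: exp_add[symmetric] algebra_simps)
  finally show ?case by blast
qed

section \<open>Lattice points and nets of the sphere\<close>

lemma sum_half_power_abs: "(\<Sum>j\<in>{- int S..int S}. (1/2::real) ^ nat \<bar>j\<bar>) = 3 - 2 * (1/2) ^ S"
proof (induction S)
  case (Suc S)
  have "{- int (Suc S)..int (Suc S)} = insert (- int (Suc S)) (insert (int (Suc S)) {- int S..int S})"
    by auto
  then have "(\<Sum>j\<in>{- int (Suc S)..int (Suc S)}. (1/2::real) ^ nat \<bar>j\<bar>)
    = (1/2) ^ nat \<bar>- int (Suc S)\<bar> + ((1/2) ^ nat \<bar>int (Suc S)\<bar> + (\<Sum>j\<in>{- int S..int S}. (1/2::real) ^ nat \<bar>j\<bar>))"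
    by (simp del: of_nat_Suc)
  also have "nat \<bar>- int (Suc S)\<bar> = Suc S" by simp
  also have "nat \<bar>int (Suc S)\<bar> = Suc S" by simp
  finally show ?case using Suc by simp
qed simp

text \<open>Extensional functions into a bounded box form a finite set, over which a product of
  coordinate weights can be summed coordinate by coordinate.\<close>

definition l1_ball :: "nat \<Rightarrow> nat \<Rightarrow> (nat \<Rightarrow> int) set" where
  "l1_ball n S = {z \<in> {..<n} \<rightarrow>\<^sub>E {- int S..int S}. (\<Sum>i<n. nat \<bar>z i\<bar>) \<le> S}"

lemma finite_l1_ball: "finite (l1_ball n S)"
  unfolding l1_ball_def by (rule finite_subset[of _ "{..<n} \<rightarrow>\<^sub>E {- int S..int S}"]) (auto intro!: finite_PiE)

text \<open>Give \<open>z\<close> the weight \<open>2 ^ S\<close> times the product of the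
  \<open>(1/2) ^ nat \<bar>z i\<bar>\<close>. It is at least 1 on the ball, and its sum over the
  whole box factorises into partial sums of a two-sided geometric series of value 3.\<close>

lemma card_l1_ball: "real (card (l1_ball n S)) \<le> 2 ^ S * 3 ^ n"
proof -
  let ?P = "{..<n} \<rightarrow>\<^sub>E {- int S..int S}"
  have fin: "finite ?P" by (auto intro!: finite_PiE)
  have "real (card (l1_ball n S)) = (\<Sum>z\<in>l1_ball n S. 1)" by simp
  also have "\<dots> \<le> (\<Sum>z\<in>l1_ball n S. 2 ^ S * (\<Prod>i<n. (1/2) ^ nat \<bar>z i\<bar>))"
  proof (rule sum_mono)
    fix z assume "z \<in> l1_ball n S"
    then have "(\<Sum>i<n. nat \<bar>z i\<bar>) \<le> S" by (simp add: l1_ball_def)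
    then have "(1/2::real) ^ S \<le> (1/2) ^ (\<Sum>i<n. nat \<bar>z i\<bar>)" by (intro power_decreasing) auto
    then show "1 \<le> 2 ^ S * (\<Prod>i<n. (1/2::real) ^ nat \<bar>z i\<bar>)"
      by (simp only: power_sum[symmetric]) (simp add: power_one_over field_simps)
  qed
  also have "\<dots> \<le> (\<Sum>z\<in>?P. 2 ^ S * (\<Prod>i<n. (1/2) ^ nat \<bar>z i\<bar>))"
  proof (rule sum_mono2[OF fin])
    show "l1_ball n S \<subseteq> ?P" unfolding l1_ball_def by (rule Collect_subset)
  qed (simp add: prod_nonneg)
  also have "\<dots> = 2 ^ S * (\<Prod>i<n. \<Sum>j\<in>{- int S..int S}. (1/2) ^ nat \<bar>j\<bar>)"
    by (subst prod_sum_PiE) (auto simp: sum_distrib_left)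
  also have "\<dots> \<le> 2 ^ S * (\<Prod>i<n. 3)"
    unfolding sum_half_power_abs
  proof (intro mult_left_mono prod_mono conjI)
    show "0 \<le> 3 - 2 * (1/2::real) ^ S" using power_le_one[of "1/2::real" S] by simp
  qed auto
  finally show ?thesis by simp
qed

text \<open>Half-integer grid points have no vanishing coordinate, as the Gaussian lemma requires.\<close>

lemma exists_sphere_net:
  assumes n: "n > 0" and \<eta>: "0 < \<eta>" "\<eta> \<le> 1/2"
  shows "\<exists>T::(nat \<Rightarrow> real) set. finite T \<and> real (card T) \<le> exp (2 * real n / \<eta>) \<and>
     (\<forall>w\<in>T. \<forall>i<n. w i \<noteq> 0) \<and> (\<forall>w\<in>T. 1/4 \<le> dot n w w \<and> dot n w w \<le> 4) \<and>
     (\<forall>v. dot n v v = 1 \<longrightarrow> (\<exists>w\<in>T. dot n (\<lambda>i. v i - w i) (\<lambda>i. v i - w i) \<le> \<eta>\<^sup>2))"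
proof -
  \<comment> \<open>With this mesh the half-diagonal of a grid cell is exactly
    \<open>\<eta>\<close>, since \<open>n * (h/2)\<^sup>2 = \<eta>\<^sup>2\<close>.\<close>
  define h where "h = 2 * \<eta> / sqrt n"
  \<comment> \<open>A grid point of norm at most 2 has l1 norm at most \<open>2 * sqrt n\<close>,
    and \<open>\<bar>z i\<bar>\<close> is at most \<open>\<bar>w i\<bar> / h + 1/2\<close>. Summing
    over \<open>i\<close> gives this bound.\<close>
  define S where "S = nat \<lfloor>n / \<eta> + n / 2\<rfloor>"
  define pt where "pt = (\<lambda>(z::nat \<Rightarrow> int) i. (of_int (z i) + 1/2) * h)"
  define T where "T = {w \<in> pt ` l1_ball n S. 1/4 \<le> dot n w w \<and> dot n w w \<le> 4}"
  have h: "h > 0" using n \<eta> by (simp add: h_def)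
  have fin: "finite T" unfolding T_def using finite_l1_ball by auto
  have S: "real S \<le> n / \<eta> + n / 2" unfolding S_def using \<eta> by (simp add: of_nat_floor)
  have "card T \<le> card (l1_ball n S)"
    unfolding T_def using finite_l1_ball
    by (metis (no_types, lifting) card_image_le card_mono finite_imageI mem_Collect_eq order_trans subsetI)
  then have "real (card T) \<le> real (card (l1_ball n S))" by simp
  also have "\<dots> \<le> 2 ^ S * 3 ^ n" by (rule card_l1_ball)
  also have "\<dots> \<le> exp (real S) * exp (3/2 * real n)"
  proof (intro mult_mono)
    have "(2::real) \<le> exp 1" using exp_ge_add_one_self[of 1] by simp
    then have "(2::real) ^ S \<le> exp 1 ^ S" by (intro power_mono) auto
    then show "(2::real) ^ S \<le> exp (real S)" by (simp add: exp_of_nat_mult[symmetric])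
    have "(3::real) \<le> exp (3/2)" using exp_lower_Taylor_quadratic[of "3/2::real"] by (simp add: power2_eq_square)
    then have "(3::real) ^ n \<le> exp (3/2) ^ n" by (intro power_mono) auto
    then show "(3::real) ^ n \<le> exp (3/2 * real n)" by (simp add: exp_of_nat2_mult[symmetric])
  qed auto
  also have "\<dots> = exp (real S + 3/2 * n)" by (simp add: exp_add)
  also have "\<dots> \<le> exp (2 * real n / \<eta>)"
  proof -
    have "n * 2 \<le> n / \<eta>" using \<eta> n by (simp add: field_simps)
    then show ?thesis using S by simp
  qed
  finally have card: "real (card T) \<le> exp (2 * real n / \<eta>)" .
  have half: "of_int z + 1/2 \<noteq> (0::real)" for z :: int
  proof
    assume "of_int z + 1/2 = (0::real)"
    then have "of_int (2 * z + 1) = (0::real)" by simp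
    then have "2 * z + 1 = 0" by (simp only: of_int_eq_0_iff)
    then show False by presburger
  qed
  have nz: "\<forall>w\<in>T. \<forall>i<n. w i \<noteq> 0" unfolding T_def pt_def using h half by auto
  have approx: "\<exists>w\<in>T. dot n (\<lambda>i. v i - w i) (\<lambda>i. v i - w i) \<le> \<eta>\<^sup>2" if v: "dot n v v = 1" for v
  proof -
    \<comment> \<open>The floor selects the grid cell that contains \<open>v\<close>, and
      \<open>w\<close> is its centre, so each coordinate is off by at most
      \<open>h/2\<close>.\<close>
    define z where "z = (\<lambda>i\<in>{..<n}. \<lfloor>v i / h\<rfloor>)"
    define w where "w = pt z"
    have vw: "\<bar>v i - w i\<bar> \<le> h / 2" if "i < n" for i
    proof -
      have "v i - w i = (v i / h - \<lfloor>v i / h\<rfloor> - 1/2) * h" using h that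
        by (simp add: w_def pt_def z_def field_simps)
      moreover have "\<bar>v i / h - \<lfloor>v i / h\<rfloor> - 1/2\<bar> \<le> 1/2" by linarith
      ultimately show ?thesis using h mult_right_mono[of "\<bar>v i / h - \<lfloor>v i / h\<rfloor> - 1/2\<bar>" "1/2" h] by (simp add: abs_mult)
    qed
    have "dot n (\<lambda>i. v i - w i) (\<lambda>i. v i - w i) \<le> (\<Sum>i<n. (h/2)\<^sup>2)"
      unfolding dot_def 
    proof (rule sum_mono)
      fix i assume "i \<in> {..<n}"
      then show "(v i - w i) * (v i - w i) \<le> (h/2)\<^sup>2"
        using vw[of i] abs_le_square_iff[of "v i - w i" "h/2"] h by (simp add: power2_eq_square)
    qed
    also have "\<dots> = \<eta>\<^sup>2" using n by (simp add: h_def power_divide power_mult_distrib)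
    finally have d: "dot n (\<lambda>i. v i - w i) (\<lambda>i. v i - w i) \<le> \<eta>\<^sup>2" .
    then have sd: "sqrt (dot n (\<lambda>i. v i - w i) (\<lambda>i. v i - w i)) \<le> \<eta>" using \<eta> by (simp add: real_le_lsqrt)
    have d': "dot n (\<lambda>i. w i - v i) (\<lambda>i. w i - v i) = dot n (\<lambda>i. v i - w i) (\<lambda>i. v i - w i)"
      by (auto simp: dot_def algebra_simps intro!: sum.cong)
    have "1 \<le> sqrt (dot n w w) + \<eta>"
      using dot_triangle[of n w "\<lambda>i. v i - w i"] sd v by simp
    then have "1/2 \<le> sqrt (dot n w w)" using \<eta> by simp
    then have lo: "1/4 \<le> dot n w w" using power_mono[of "1/2" "sqrt (dot n w w)" 2] dot_self_nonneg[of n w]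
      by (simp add: power2_eq_square)
    have "sqrt (dot n w w) \<le> 1 + \<eta>"
      using dot_triangle[of n v "\<lambda>i. w i - v i"] sd v d' by simp
    then have "sqrt (dot n w w) \<le> 2" using \<eta> by simp
    then have hi: "dot n w w \<le> 4" using sqrt_le_D by fastforce
    have l1: "(\<Sum>i<n. \<bar>w i\<bar>) \<le> 2 * sqrt n"
    proof -
      have "(\<Sum>i<n. \<bar>w i\<bar> * 1)\<^sup>2 \<le> (\<Sum>i<n. \<bar>w i\<bar>\<^sup>2) * (\<Sum>i<n. 1\<^sup>2)" by (rule Cauchy_Schwarz_ineq_sum)
      also have "\<dots> \<le> 4 * real n" using hi by (auto simp: dot_def power2_eq_square intro!: mult_right_mono)
      also have "\<dots> = (2 * sqrt n)\<^sup>2" by (simp add: power_mult_distrib)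
      finally show ?thesis using power2_le_imp_le[of "\<Sum>i<n. \<bar>w i\<bar>" "2 * sqrt n"] by simp
    qed
    have "(\<Sum>i<n. real_of_int \<bar>z i\<bar>) \<le> (\<Sum>i<n. \<bar>w i\<bar> / h + 1/2)"
    proof (rule sum_mono)
      fix i assume "i \<in> {..<n}"
      have "\<bar>w i\<bar> / h = \<bar>of_int (z i) + 1/2\<bar>" using h by (simp add: w_def pt_def abs_mult)
      then show "real_of_int \<bar>z i\<bar> \<le> \<bar>w i\<bar> / h + 1/2" by linarith
    qed
    also have "\<dots> = (\<Sum>i<n. \<bar>w i\<bar>) / h + n / 2" by (simp add: sum.distrib sum_divide_distrib)
    also have "\<dots> \<le> 2 * sqrt n / h + n / 2" using l1 h by (simp add: divide_right_mono)
    also have "2 * sqrt n / h = n / \<eta>" using n \<eta> by (simp add: h_def field_simps)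
    finally have "real (\<Sum>i<n. nat \<bar>z i\<bar>) \<le> n / \<eta> + n / 2" by simp
    then have zS: "(\<Sum>i<n. nat \<bar>z i\<bar>) \<le> S" unfolding S_def by (simp add: le_nat_floor)
    have "z i \<in> {- int S..int S}" if "i < n" for i
    proof -
      have "nat \<bar>z i\<bar> \<le> (\<Sum>i<n. nat \<bar>z i\<bar>)" using that by (intro member_le_sum) auto
      then show ?thesis using zS by auto
    qed
    then have "z \<in> l1_ball n S" using zS by (auto simp: l1_ball_def z_def)
    then have "w \<in> T" using lo hi by (auto simp: T_def w_def)
    then show ?thesis using d by blast
  qed
  show ?thesis using fin card nz approx by (intro exI[of _ T]) (auto simp: T_def)
qed

section \<open>From the net to the whole sphere\<close>

text \<open>The number of vectors is large enough for the logarithm of the size of the net to be at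
  most \<open>\<delta>/4 * N\<close>, so the total potential at each net point is at most
  \<open>\<delta>/2 * N\<close>. This bounds both the small inner products and the sum of squares on
  the net. The sum of squares is carried to the sphere first, and then controls the error in
  carrying over the count.\<close>

lemma exists_robust_frame:
  fixes n N :: nat and \<delta> :: real
  assumes n: "n > 0" and \<delta>: "0 < \<delta>" "\<delta> \<le> 1" and N: "2^14 * real n / \<delta>^3 \<le> N"
  shows "\<exists>f. (\<forall>v. (\<Sum>k<N. (dot n (f k) v)\<^sup>2) \<le> 512 * real N * dot n v v) \<and>
     (\<forall>v. dot n v v = 1 \<longrightarrow> real (card {k\<in>{..<N}. \<bar>dot n (f k) v\<bar> < \<delta>/64}) \<le> \<delta> * N)"
proof -
  \<comment> \<open>With this value \<open>2 * n / \<eta> \<le> \<delta>/4 * N\<close> is exactly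
    the hypothesis on \<open>N\<close>, and the error count below is at most
    \<open>\<delta>/2 * N\<close>.\<close>
  define \<eta> where "\<eta> = \<delta>\<^sup>2 / 2^11"
  have "\<delta>\<^sup>2 \<le> 1" using \<delta> by (simp add: power_le_one)
  then have \<eta>: "0 < \<eta>" "\<eta> \<le> 1/2" using \<delta> by (auto simp: \<eta>_def)
  obtain T :: "(nat \<Rightarrow> real) set" where fin: "finite T" and card: "real (card T) \<le> exp (2 * real n / \<eta>)"
    and nz: "\<forall>w\<in>T. \<forall>i<n. w i \<noteq> 0" and norm: "\<forall>w\<in>T. 1/4 \<le> dot n w w \<and> dot n w w \<le> 4"
    and net: "\<forall>v. dot n v v = 1 \<longrightarrow> (\<exists>w\<in>T. dot n (\<lambda>i. v i - w i) (\<lambda>i. v i - w i) \<le> \<eta>\<^sup>2)"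
    using exists_sphere_net[OF n \<eta>] by (elim exE conjE) (rule that; assumption)
  obtain f where f: "(\<Sum>w\<in>T. exp (\<Sum>k<N. potential \<delta> (dot n (f k) w))) \<le> exp (\<delta>/4 * N) * card T"
    using exists_vectors_small_potential[of n \<delta> T N, OF n \<delta> fin] nz norm by auto
  have pot: "(\<Sum>k<N. potential \<delta> (dot n (f k) w)) \<le> \<delta>/2 * N" if "w \<in> T" for w
  proof -
    have "2 * real n / \<eta> \<le> \<delta>/4 * N"
      using N \<delta> by (simp add: \<eta>_def field_simps power2_eq_square power3_eq_cube)
    then have c: "real (card T) \<le> exp (\<delta>/4 * N)" using card by (meson exp_le_cancel_iff order_trans)
    have "exp (\<Sum>k<N. potential \<delta> (dot n (f k) w)) \<le> (\<Sum>w\<in>T. exp (\<Sum>k<N. potential \<delta> (dot n (f k) w)))"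
      using fin that by (intro member_le_sum) auto
    also note f
    also have "exp (\<delta>/4 * N) * card T \<le> exp (\<delta>/4 * N) * exp (\<delta>/4 * N)" using c by (intro mult_left_mono) auto
    also have "\<dots> = exp (\<delta>/2 * N)" by (simp add: exp_add[symmetric])
    finally show ?thesis by simp
  qed
  have small: "real (card {k\<in>{..<N}. \<bar>dot n (f k) w\<bar> < \<delta>/32}) \<le> \<delta>/2 * N" if "w \<in> T" for w
  proof -
    have "real (card {k\<in>{..<N}. \<bar>dot n (f k) w\<bar> < \<delta>/32}) = (\<Sum>k<N. if \<bar>dot n (f k) w\<bar> < \<delta>/32 then 1 else 0)"
      by (simp add: sum.If_cases Int_def)
    also have "\<dots> \<le> (\<Sum>k<N. potential \<delta> (dot n (f k) w))"
      using \<delta> by (intro sum_mono) (simp add: potential_def)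
    finally show ?thesis using pot[OF that] by simp
  qed
  have squares: "(\<Sum>k<N. (dot n (f k) w)\<^sup>2) \<le> 128 * real N" if "w \<in> T" for w
  proof -
    have "\<delta>/256 * (\<Sum>k<N. (dot n (f k) w)\<^sup>2) \<le> (\<Sum>k<N. potential \<delta> (dot n (f k) w))"
      unfolding sum_distrib_left by (intro sum_mono) (simp add: potential_def)
    also note pot[OF that]
    finally show ?thesis using \<delta> by (simp add: field_simps)
  qed
  define q where "q = (\<lambda>v. L2_set (\<lambda>k. dot n (f k) v) {..<N})"
  have q2: "(q v)\<^sup>2 = (\<Sum>k<N. (dot n (f k) v)\<^sup>2)" for v
    by (simp add: q_def L2_set_def sum_nonneg)
  have q0: "0 \<le> q v" for v by (simp add: q_def L2_set_nonneg)
  \<comment> \<open>This crude Frobenius bound only ensures that the supremum \<open>S\<close>, the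
    operator norm of the frame, is finite.\<close>
  define B where "B = sqrt (\<Sum>k<N. dot n (f k) (f k))"
  have qB: "q v \<le> B * sqrt (dot n v v)" for v
    unfolding q_def L2_set_def B_def real_sqrt_mult[symmetric] sum_distrib_right
    by (intro real_sqrt_le_mono sum_mono dot_Cauchy_Schwarz)
  define S where "S = (SUP v\<in>{v. dot n v v = 1}. q v)"
  have bdd: "bdd_above (q ` {v. dot n v v = 1})"
  proof (rule bdd_aboveI2)
    fix v assume "v \<in> {v. dot n v v = 1}"
    then show "q v \<le> B" using qB[of v] by simp
  qed
  have qS1: "q v \<le> S" if "dot n v v = 1" for v
    unfolding S_def using that by (intro cSUP_upper bdd) auto
  have qS: "q v \<le> S * sqrt (dot n v v)" for v
  proof (cases "dot n v v = 0")
    case True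
    then show ?thesis using qB[of v] by simp
  next
    case False
    then have pos: "dot n v v > 0" using dot_self_nonneg[of n v] by linarith
    define c where "c = sqrt (dot n v v)"
    have c: "c > 0" using pos by (simp add: c_def)
    have "dot n (\<lambda>i. v i / c) (\<lambda>i. v i / c) = dot n v v / c\<^sup>2"
      by (simp add: dot_def sum_divide_distrib power2_eq_square)
    then have u: "dot n (\<lambda>i. v i / c) (\<lambda>i. v i / c) = 1" using pos by (simp add: c_def)
    have "dot n (f k) v = c * dot n (f k) (\<lambda>i. v i / c)" for k
      using c by (simp add: dot_def sum_divide_distrib[symmetric])
    then have "q v = c * q (\<lambda>i. v i / c)"
      using c by (simp add: q_def L2_set_right_distrib)
    then show ?thesis using qS1[OF u] c by (simp add: c_def mult.commute)
  qed
  have qtri: "q v \<le> q w + q (\<lambda>i. v i - w i)" for v w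
  proof -
    have "dot n (f k) v = dot n (f k) w + dot n (f k) (\<lambda>i. v i - w i)" for k
      by (simp add: dot_def sum.distrib[symmetric] algebra_simps)
    then show ?thesis unfolding q_def using L2_set_triangle_ineq by simp
  qed
  define e0 where "e0 = (\<lambda>i::nat. if i = 0 then 1 else 0 :: real)"
  have "dot n e0 e0 = (\<Sum>i<n. if i = 0 then 1 else 0)" unfolding dot_def e0_def by (intro sum.cong) auto
  then have e0: "dot n e0 e0 = 1" using n by simp
  have Spos: "0 \<le> S" using qS1[OF e0] q0[of e0] by linarith
  \<comment> \<open>Bootstrap: replacing a unit vector by its net point leaves an error of norm at
    most 1/2, which costs at most \<open>S / 2\<close>.\<close>
  have "S \<le> sqrt (128 * real N) + S / 2"
    unfolding S_def
  proof (rule cSUP_least)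
    show "{v. dot n v v = 1} \<noteq> {}" using e0 by auto
    fix v assume "v \<in> {v. dot n v v = 1}"
    then obtain w where w: "w \<in> T" "dot n (\<lambda>i. v i - w i) (\<lambda>i. v i - w i) \<le> \<eta>\<^sup>2" using net by auto
    have "q w \<le> sqrt (128 * real N)" using squares[OF w(1)] q2[of w] by (intro real_le_rsqrt) simp
    moreover have "sqrt (dot n (\<lambda>i. v i - w i) (\<lambda>i. v i - w i)) \<le> 1/2"
      using real_sqrt_le_mono[OF w(2)] \<eta> by simp
    then have "q (\<lambda>i. v i - w i) \<le> S * (1/2)"
      using qS[of "\<lambda>i. v i - w i"] Spos by (meson mult_left_mono order_trans)
    ultimately show "q v \<le> sqrt (128 * real N) + (SUP v\<in>{v. dot n v v = 1}. q v) / 2"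
      using qtri[of v w] by (simp add: S_def)
  qed
  then have "S \<le> 2 * sqrt (128 * real N)" by simp
  then have "S\<^sup>2 \<le> (2 * sqrt (128 * real N))\<^sup>2" using Spos by (intro power_mono)
  then have S2: "S\<^sup>2 \<le> 512 * real N" by (simp add: power_mult_distrib)
  have upper: "(\<Sum>k<N. (dot n (f k) v)\<^sup>2) \<le> 512 * real N * dot n v v" for v
  proof -
    have "(q v)\<^sup>2 \<le> (S * sqrt (dot n v v))\<^sup>2" using qS q0 by (intro power_mono)
    also have "\<dots> = S\<^sup>2 * dot n v v" using dot_self_nonneg[of n v] by (simp add: power_mult_distrib)
    also have "\<dots> \<le> 512 * real N * dot n v v" using S2 dot_self_nonneg[of n v] by (intro mult_right_mono)
    finally show ?thesis by (simp add: q2)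
  qed
  have "real (card {k\<in>{..<N}. \<bar>dot n (f k) v\<bar> < \<delta>/64}) \<le> \<delta> * N" if v: "dot n v v = 1" for v
  proof -
    obtain w where w: "w \<in> T" "dot n (\<lambda>i. v i - w i) (\<lambda>i. v i - w i) \<le> \<eta>\<^sup>2" using net v by auto
    define e where "e = (\<lambda>i. v i - w i)"
    let ?X = "{k\<in>{..<N}. \<bar>dot n (f k) v\<bar> < \<delta>/64}"
    let ?Y = "{k\<in>{..<N}. \<bar>dot n (f k) w\<bar> < \<delta>/32}"
    let ?Z = "{k\<in>{..<N}. \<delta>/64 \<le> \<bar>dot n (f k) e\<bar>}"
    have "dot n (f k) w = dot n (f k) v - dot n (f k) e" for k
      by (simp add: dot_def e_def sum_subtractf[symmetric] algebra_simps)
    then have tri: "\<bar>dot n (f k) w\<bar> \<le> \<bar>dot n (f k) v\<bar> + \<bar>dot n (f k) e\<bar>" for k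
      by (metis abs_triangle_ineq4)
    \<comment> \<open>A small inner product with \<open>v\<close> is small with \<open>w\<close>
      too, unless the inner product with the error \<open>e\<close> is large. The latter case is
      rare by Chebyshev's inequality and \<open>upper\<close>.\<close>
    have "?X \<subseteq> ?Y \<union> ?Z"
    proof
      fix k assume "k \<in> ?X"
      then show "k \<in> ?Y \<union> ?Z" using tri[of k] by (cases "\<delta>/64 \<le> \<bar>dot n (f k) e\<bar>") auto
    qed
    then have "card ?X \<le> card (?Y \<union> ?Z)" by (intro card_mono) auto
    also have "\<dots> \<le> card ?Y + card ?Z" by (rule card_Un_le)
    finally have XYZ: "real (card ?X) \<le> real (card ?Y) + real (card ?Z)" by linarith
    have "(\<delta>/64)\<^sup>2 * card ?Z = (\<Sum>k\<in>?Z. (\<delta>/64)\<^sup>2)" by simp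
    also have "\<dots> \<le> (\<Sum>k\<in>?Z. (dot n (f k) e)\<^sup>2)"
    proof (rule sum_mono)
      fix k assume "k \<in> ?Z"
      then have "\<bar>\<delta>/64\<bar> \<le> \<bar>dot n (f k) e\<bar>" using \<delta> by simp
      then show "(\<delta>/64)\<^sup>2 \<le> (dot n (f k) e)\<^sup>2" by (simp only: abs_le_square_iff)
    qed
    also have "\<dots> \<le> (\<Sum>k<N. (dot n (f k) e)\<^sup>2)" by (intro sum_mono2) auto
    also have "\<dots> \<le> 512 * real N * dot n e e" by (rule upper)
    also have "\<dots> \<le> 512 * real N * \<eta>\<^sup>2" using w(2) unfolding e_def by (intro mult_left_mono) auto
    finally have "real (card ?Z) \<le> 512 * real N * \<eta>\<^sup>2 / (\<delta>/64)\<^sup>2" using \<delta> by (simp add: field_simps)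
    also have "\<dots> = \<delta>/2 * N * \<delta>" using \<delta> by (simp add: \<eta>_def field_simps power2_eq_square)
    also have "\<dots> \<le> \<delta>/2 * N * 1" using \<delta> by (intro mult_left_mono) auto
    finally show ?thesis using XYZ small[OF w(1)] by simp
  qed
  then show ?thesis using upper by (intro exI[of _ f]) auto
qed

text \<open>
  Scaling each vector of a robust frame by \<open>0, 1/J, \<dots>, (J-1)/J\<close> makes the small-ball estimate
  stable under a shift \<open>a\<close>: for a fixed direction at most one multiple can come close to \<open>-a\<close>.
\<close>

lemma exists_shift_robust_frame:
  fixes n N J :: nat and \<delta> :: real
  assumes n: "n > 0" and \<delta>: "0 < \<delta>" "\<delta> \<le> 1" and N: "2^14 * real n / \<delta>^3 \<le> N" and J: "1 / \<delta> \<le> J"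
  shows "\<exists>g. (\<forall>v. (\<Sum>k<N*J. (dot n (g k) v)\<^sup>2) \<le> 512 * real (N * J) * dot n v v) \<and>
     (\<forall>v a. dot n v v = 1 \<longrightarrow> real (card {k\<in>{..<N*J}. \<bar>a + dot n (g k) v\<bar> < \<delta>/(128 * real J)}) \<le> 2 * \<delta> * real (N * J))"
proof -
  obtain f where f1: "\<forall>v. (\<Sum>k<N. (dot n (f k) v)\<^sup>2) \<le> 512 * real N * dot n v v"
    and f2: "\<forall>v. dot n v v = 1 \<longrightarrow> real (card {k\<in>{..<N}. \<bar>dot n (f k) v\<bar> < \<delta>/64}) \<le> \<delta> * N"
    using exists_robust_frame[OF n \<delta> N] by (elim exE conjE) (rule that; assumption)
  \<comment> \<open>The index \<open>k\<close> encodes the pair of a frame vector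
    \<open>k div J\<close> and a multiple \<open>k mod J\<close>.\<close>
  define g where "g = (\<lambda>k i. real (k mod J) / J * f (k div J) i)"
  have J0: "J > 0" using J \<delta> by (cases J) (auto simp: field_simps)
  have dotg: "dot n (g k) v = real (k mod J) / J * dot n (f (k div J)) v" for k v
    by (simp add: dot_def g_def sum_distrib_left mult.assoc)
  have bij: "bij_betw (\<lambda>(l, j). l * J + j) ({..<N} \<times> {..<J}) {..<N*J}"
  proof (rule bij_betwI[where g = "\<lambda>k. (k div J, k mod J)"])
    show "(\<lambda>(l, j). l * J + j) \<in> {..<N} \<times> {..<J} \<rightarrow> {..<N*J}"
    proof (clarsimp)
      fix l j assume lj: "l < N" "j < J"
      then have "l * J + j < Suc l * J" by simp
      also have "\<dots> \<le> N * J" using lj by (intro mult_right_mono) auto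
      finally show "l * J + j < N * J" .
    qed
  qed (use J0 in \<open>auto simp: less_mult_imp_div_less\<close>)
  have upper: "(\<Sum>k<N*J. (dot n (g k) v)\<^sup>2) \<le> 512 * real (N * J) * dot n v v" for v
  proof -
    have "(\<Sum>k<N*J. (dot n (g k) v)\<^sup>2) = (\<Sum>(l, j)\<in>{..<N}\<times>{..<J}. (real j / J * dot n (f l) v)\<^sup>2)"
      by (subst sum.reindex_bij_betw[OF bij, symmetric]) (auto simp: dotg intro!: sum.cong)
    also have "\<dots> = (\<Sum>l<N. \<Sum>j<J. (real j / J * dot n (f l) v)\<^sup>2)"
      by (rule sum.cartesian_product[symmetric])
    also have "\<dots> \<le> (\<Sum>l<N. \<Sum>j<J. (dot n (f l) v)\<^sup>2)"
    proof (intro sum_mono)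
      fix l j assume "j \<in> {..<J}"
      then have "(real j / J)\<^sup>2 \<le> 1" by (intro power_le_one) auto
      then show "(real j / J * dot n (f l) v)\<^sup>2 \<le> (dot n (f l) v)\<^sup>2"
        unfolding power_mult_distrib using mult_right_mono[of "(real j / J)\<^sup>2" 1 "(dot n (f l) v)\<^sup>2"] by simp
    qed
    also have "\<dots> = J * (\<Sum>l<N. (dot n (f l) v)\<^sup>2)" by (simp add: sum_distrib_left)
    also have "\<dots> \<le> J * (512 * real N * dot n v v)" using f1 by (intro mult_left_mono) auto
    finally show ?thesis by (simp add: mult_ac)
  qed
  have "real (card {k\<in>{..<N*J}. \<bar>a + dot n (g k) v\<bar> < \<delta>/(128 * real J)}) \<le> 2 * \<delta> * real (N * J)"
    if v: "dot n v v = 1" for v a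
  proof -
    define P where "P = (\<lambda>l j. \<bar>a + real j / J * dot n (f l) v\<bar> < \<delta>/(128 * real J))"
    let ?B = "{l\<in>{..<N}. \<bar>dot n (f l) v\<bar> < \<delta>/64}"
    have one: "card {j\<in>{..<J}. P l j} \<le> 1" if "\<not> \<bar>dot n (f l) v\<bar> < \<delta>/64" for l
    proof -
      \<comment> \<open>Two distinct multiples of an inner product of size at least
        \<open>\<delta>/64\<close> are at least \<open>\<delta>/(64 * J)\<close> apart, which is
        twice the threshold.\<close>
      have "j = j'" if "P l j" "P l j'" for j j'
      proof (rule ccontr)
        assume "j \<noteq> j'"
        then have "1 \<le> \<bar>real j - real j'\<bar>" by linarith
        then have "\<delta>/64 * 1 \<le> \<bar>dot n (f l) v\<bar> * \<bar>real j - real j'\<bar>"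
          using \<open>\<not> \<bar>dot n (f l) v\<bar> < \<delta>/64\<close> \<delta> by (intro mult_mono) auto
        then have "\<delta>/64/J \<le> \<bar>dot n (f l) v\<bar> * \<bar>real j - real j'\<bar> / J"
          using J0 by (intro divide_right_mono) auto
        also have "\<dots> = \<bar>(a + real j / J * dot n (f l) v) - (a + real j' / J * dot n (f l) v)\<bar>"
        proof -
          have "(a + real j / J * dot n (f l) v) - (a + real j' / J * dot n (f l) v)
            = dot n (f l) v * (real j - real j') / J" using J0 by (simp add: field_simps)
          then show ?thesis by (simp only: abs_mult abs_divide abs_of_nat)
        qed
        also have "\<dots> < \<delta>/(128 * real J) + \<delta>/(128 * real J)"
          using that unfolding P_def by (rule order.strict_trans1[OF abs_triangle_ineq4 add_strict_mono])
        finally show False using J0 by (simp add: field_simps)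
      qed
      then show ?thesis by (auto simp: card_le_Suc0_iff_eq)
    qed
    have "real (card {k\<in>{..<N*J}. \<bar>a + dot n (g k) v\<bar> < \<delta>/(128 * real J)})
      = (\<Sum>k<N*J. if \<bar>a + dot n (g k) v\<bar> < \<delta>/(128 * real J) then 1 else 0)"
      by (simp add: sum.If_cases Int_def)
    also have "\<dots> = (\<Sum>(l, j)\<in>{..<N}\<times>{..<J}. if P l j then 1 else 0)"
      by (subst sum.reindex_bij_betw[OF bij, symmetric]) (auto simp: dotg P_def intro!: sum.cong)
    also have "\<dots> = (\<Sum>l<N. \<Sum>j<J. if P l j then 1 else 0)"
      by (rule sum.cartesian_product[symmetric])
    also have "\<dots> = (\<Sum>l<N. real (card {j\<in>{..<J}. P l j}))"
      by (simp add: sum.If_cases Int_def)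
    \<comment> \<open>A frame vector nearly orthogonal to \<open>v\<close> may lose all its
      \<open>J\<close> multiples, any other at most one. The total of these single losses is
      \<open>N\<close>, at most \<open>\<delta> * J * N\<close> by the choice of
      \<open>J\<close>.\<close>
    also have "\<dots> \<le> (\<Sum>l<N. (if \<bar>dot n (f l) v\<bar> < \<delta>/64 then real J else 0) + 1)"
    proof (rule sum_mono)
      fix l
      have "card {j\<in>{..<J}. P l j} \<le> card {..<J}" by (intro card_mono) auto
      then show "real (card {j\<in>{..<J}. P l j}) \<le> (if \<bar>dot n (f l) v\<bar> < \<delta>/64 then real J else 0) + 1"
        using one[of l] by auto
    qed
    also have "\<dots> = J * real (card ?B) + N"
      by (simp add: sum.distrib sum.If_cases Int_def)
    also have "\<dots> \<le> J * (\<delta> * N) + \<delta> * J * N"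
    proof (intro add_mono mult_left_mono f2[rule_format] v)
      have "1 \<le> \<delta> * J" using J \<delta> by (simp add: field_simps)
      then show "real N \<le> \<delta> * J * N" using mult_right_mono[of 1 "\<delta> * J" "real N"] by simp
    qed simp
    finally show ?thesis by (simp add: mult_ac)
  qed
  then show ?thesis using upper by (intro exI[of _ g]) auto
qed

section \<open>Random sums of rank-one matrices\<close>

text \<open>If the transpose of \<open>M\<close> is singular, a kernel vector serves with
  \<open>a = 0\<close>. Otherwise its preimage of \<open>u\<close> is nonzero and can be
  normalised.\<close>

lemma exists_unit_preimage_of_line:
  fixes M :: "nat \<Rightarrow> nat \<Rightarrow> real" and u :: "nat \<Rightarrow> real"
  assumes u: "\<exists>j<n. u j \<noteq> 0"
  shows "\<exists>w a. dot n w w = 1 \<and> (\<forall>j<n. (\<Sum>i<n. M i j * w i) = a * u j)"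
proof -
  define A where "A = mat n n (\<lambda>(i, j). M j i)"
  have A: "A \<in> carrier_mat n n" by (simp add: A_def)
  have Av: "(A *\<^sub>v v) $ j = (\<Sum>i<n. M i j * v $ i)" if "v \<in> carrier_vec n" "j < n" for v j
    using that by (simp add: A_def scalar_prod_def lessThan_atLeast0)
  obtain v c where v: "v \<in> carrier_vec n" "v \<noteq> 0\<^sub>v n" and c: "\<And>j. j < n \<Longrightarrow> (A *\<^sub>v v) $ j = c * u j"
  proof (cases "Determinant.det A = 0")
    case True
    then obtain v where "v \<in> carrier_vec n" "v \<noteq> 0\<^sub>v n" "A *\<^sub>v v = 0\<^sub>v n"
      using det_0_iff_vec_prod_zero_field[OF A] by auto
    then show ?thesis using that[of v 0] by simp
  next
    case False
    then obtain B where B: "B \<in> carrier_mat n n" "A * B = 1\<^sub>m n"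
      using det_non_zero_imp_unit[OF A False, where b = "()"] 
      by (auto simp: Units_def ring_mat_def)
    define v where "v = B *\<^sub>v Matrix.vec n u"
    have v: "v \<in> carrier_vec n" using B by (simp add: v_def)
    have "A *\<^sub>v v = Matrix.vec n u" unfolding v_def using A B
      by (simp add: assoc_mult_mat_vec[symmetric, of A n n B n])
    moreover have "v \<noteq> 0\<^sub>v n"
    proof
      assume "v = 0\<^sub>v n"
      obtain j where "j < n" "u j \<noteq> 0" using u by blast
      with \<open>A *\<^sub>v v = Matrix.vec n u\<close> Av[OF v, of j] \<open>v = 0\<^sub>v n\<close> show False by simp
    qed
    ultimately show ?thesis using that[of v 1] v by simp
  qed
  define s where "s = dot n (vec_index v) (vec_index v)"
  have "\<exists>i<n. v $ i \<noteq> 0" using v by auto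
  then have s: "s > 0" unfolding s_def dot_def
    by (metis (no_types, lifting) finite_lessThan lessThan_iff not_square_less_zero not_less mult_eq_0_iff order_le_less sum_pos2)
  define w where "w = (\<lambda>i. v $ i / sqrt s)"
  have "dot n w w = s / (sqrt s * sqrt s)"
    by (simp add: dot_def w_def s_def sum_divide_distrib)
  then have "dot n w w = 1" using s by simp
  moreover have "(\<Sum>i<n. M i j * w i) = (c / sqrt s) * u j" if "j < n" for j
    using c[OF that] Av[OF v(1) that] by (simp add: w_def sum_divide_distrib[symmetric])
  ultimately show ?thesis by blast
qed

text \<open>Exchanging \<open>x k\<close> with an extra value \<open>v\<close> is an involution on
  pairs, so resampling one coordinate of a uniform \<open>x\<close> keeps it uniform. A bound valid
  for every choice of the other coordinates is then a bound for the whole set.\<close>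

lemma card_funcset_le_of_fibres:
  fixes K Q :: nat and c :: real
  assumes k: "k < K" and fib: "\<And>x. x \<in> {..<K} \<rightarrow>\<^sub>E {..<Q} \<Longrightarrow> real (card {v\<in>{..<Q}. B (x(k := v))}) \<le> c * Q"
  shows "real (card {x \<in> {..<K} \<rightarrow>\<^sub>E {..<Q}. B x}) \<le> c * card ({..<K} \<rightarrow>\<^sub>E {..<Q})"
proof -
  let ?\<Omega> = "{..<K} \<rightarrow>\<^sub>E {..<Q}"
  let ?S = "?\<Omega> \<times> {..<Q}"
  have fin: "finite ?\<Omega>" by (auto intro!: finite_PiE)
  have swap: "(\<lambda>(x, v). (x(k := v), x k)) p \<in> ?S" if "p \<in> ?S" for p
    using that k by (auto simp: PiE_def extensional_def Pi_def)
  have "Q * real (card {x \<in> ?\<Omega>. B x}) = (\<Sum>x\<in>?\<Omega>. \<Sum>v<Q. if B x then 1 else 0)"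
    using fin by (simp add: sum_distrib_left[symmetric] sum.If_cases Int_def)
  also have "\<dots> = (\<Sum>(x, v)\<in>?S. if B x then 1 else 0)" by (rule sum.cartesian_product)
  also have "\<dots> = (\<Sum>(x, v)\<in>?S. if B (x(k := v)) then 1 else 0)"
    by (rule sum.reindex_bij_witness[of _ "\<lambda>(x, v). (x(k := v), x k)" "\<lambda>(x, v). (x(k := v), x k)"])
       (use swap in auto)
  also have "\<dots> = (\<Sum>x\<in>?\<Omega>. \<Sum>v<Q. if B (x(k := v)) then 1 else 0)" by (rule sum.cartesian_product[symmetric])
  also have "\<dots> = (\<Sum>x\<in>?\<Omega>. real (card {v\<in>{..<Q}. B (x(k := v))}))"
    by (simp add: sum.If_cases Int_def)
  also have "\<dots> \<le> (\<Sum>x\<in>?\<Omega>. c * Q)" by (intro sum_mono fib)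
  finally have *: "Q * real (card {x \<in> ?\<Omega>. B x}) \<le> Q * (c * card ?\<Omega>)" by (simp add: mult_ac)
  show ?thesis
  proof (cases "Q = 0")
    case True
    then have "?\<Omega> = {}" using k by (auto simp: PiE_eq_empty_iff)
    then show ?thesis by simp
  next
    case False
    then show ?thesis using * by simp
  qed
qed

text \<open>
  Discarding every index whose frame vector is also selected by another index makes the selection
  injective, which bounds the operator norm of the perturbation for every outcome of the bits.
\<close>

definition isolated :: "nat \<Rightarrow> (nat \<Rightarrow> nat) \<Rightarrow> nat set" where
  "isolated K x = {k\<in>{..<K}. \<forall>j<K. j \<noteq> k \<longrightarrow> x j \<noteq> x k}"

definition perturbation ::
  "nat \<Rightarrow> (nat \<Rightarrow> nat \<Rightarrow> real) \<Rightarrow> (nat \<Rightarrow> nat \<Rightarrow> real) \<Rightarrow> (nat \<Rightarrow> nat) \<Rightarrow> nat \<Rightarrow> nat \<Rightarrow> real" where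
  "perturbation K g u x i j = (\<Sum>k\<in>isolated K x. g (x k) i * u k j)"

definition mat_apply :: "nat \<Rightarrow> (nat \<Rightarrow> nat \<Rightarrow> real) \<Rightarrow> (nat \<Rightarrow> real) \<Rightarrow> nat \<Rightarrow> real" where
  "mat_apply n M v i = (\<Sum>j<n. M i j * v j)"

lemma finite_isolated [simp]: "finite (isolated K x)"
  by (simp add: isolated_def)

lemma dot_perturbation:
  "dot n w (mat_apply n (perturbation K g u x) v) = (\<Sum>k\<in>isolated K x. dot n (g (x k)) w * dot n (u k) v)"
proof -
  have "dot n w (mat_apply n (perturbation K g u x) v)
     = (\<Sum>i<n. \<Sum>j<n. \<Sum>k\<in>isolated K x. (g (x k) i * w i) * (u k j * v j))"
    by (simp add: dot_def mat_apply_def perturbation_def sum_distrib_left sum_distrib_right mult_ac)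
  also have "\<dots> = (\<Sum>i<n. \<Sum>k\<in>isolated K x. \<Sum>j<n. (g (x k) i * w i) * (u k j * v j))"
    by (intro sum.cong refl sum.swap)
  also have "\<dots> = (\<Sum>k\<in>isolated K x. \<Sum>i<n. \<Sum>j<n. (g (x k) i * w i) * (u k j * v j))"
    by (rule sum.swap)
  also have "\<dots> = (\<Sum>k\<in>isolated K x. dot n (g (x k)) w * dot n (u k) v)"
    by (simp add: dot_def sum_product)
  finally show ?thesis .
qed

text \<open>Test the image \<open>z\<close> of \<open>v\<close> against itself: by Cauchy-Schwarz
  over the isolated indices, the square of \<open>dot n z z\<close> is at most
  \<open>dot n z z * dot n v v\<close>. Since \<open>x\<close> is injective on these indices, the
  \<open>g\<close>-sum is part of the full frame sum.\<close>

lemma perturbation_contraction: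
  assumes g: "\<And>v. (\<Sum>l<Q. (dot n (g l) v)\<^sup>2) \<le> dot n v v"
    and u: "\<And>v. (\<Sum>k<K. (dot n (u k) v)\<^sup>2) \<le> dot n v v"
    and x: "x \<in> {..<K} \<rightarrow>\<^sub>E {..<Q}"
  defines "R \<equiv> mat_apply n (perturbation K g u x)"
  shows "dot n (R v) (R v) \<le> dot n v v"
proof -
  let ?I = "isolated K x"
  define z where "z = R v"
  have inj: "inj_on x ?I" by (auto simp: inj_on_def isolated_def)
  have sub: "x ` ?I \<subseteq> {..<Q}" using x by (auto simp: isolated_def)
  have "(\<Sum>k\<in>?I. (dot n (g (x k)) z)\<^sup>2) = (\<Sum>l\<in>x ` ?I. (dot n (g l) z)\<^sup>2)"
    by (simp add: sum.reindex[OF inj])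
  also have "\<dots> \<le> (\<Sum>l<Q. (dot n (g l) z)\<^sup>2)" using sub by (intro sum_mono2) auto
  also have "\<dots> \<le> dot n z z" by (rule g)
  finally have 1: "(\<Sum>k\<in>?I. (dot n (g (x k)) z)\<^sup>2) \<le> dot n z z" .
  have "(\<Sum>k\<in>?I. (dot n (u k) v)\<^sup>2) \<le> (\<Sum>k<K. (dot n (u k) v)\<^sup>2)"
    by (intro sum_mono2) (auto simp: isolated_def)
  also have "\<dots> \<le> dot n v v" by (rule u)
  finally have 2: "(\<Sum>k\<in>?I. (dot n (u k) v)\<^sup>2) \<le> dot n v v" .
  have "dot n z z * dot n z z = (\<Sum>k\<in>?I. dot n (g (x k)) z * dot n (u k) v)\<^sup>2"
    using dot_perturbation[of n z K g u x v] by (simp add: z_def R_def power2_eq_square)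
  also have "\<dots> \<le> (\<Sum>k\<in>?I. (dot n (g (x k)) z)\<^sup>2) * (\<Sum>k\<in>?I. (dot n (u k) v)\<^sup>2)"
    by (rule Cauchy_Schwarz_ineq_sum)
  also have "\<dots> \<le> dot n z z * dot n v v"
    using 1 2 dot_self_nonneg by (intro mult_mono) (auto intro: sum_nonneg)
  finally have "dot n z z * dot n z z \<le> dot n z z * dot n v v" .
  then have "dot n z z \<le> dot n v v"
    using dot_self_nonneg[of n z] dot_self_nonneg[of n v] by (cases "dot n z z = 0") auto
  then show ?thesis by (simp add: z_def)
qed

text \<open>Each index is bad for at most a fraction \<open>2 * p\<close> of the outcomes:
  \<open>p\<close> for a collision and \<open>p\<close> for a small first factor. By Markov's
  inequality at least half of the indices are bad with probability at most \<open>4 * p\<close>. In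
  all other outcomes every unit \<open>v\<close> has an index at which both factors are
  large.\<close>

lemma card_ill_conditioned:
  fixes K Q n :: nat and \<epsilon> \<tau> \<tau>' p :: real and A :: "nat \<Rightarrow> nat \<Rightarrow> real"
  assumes K: "K > 0" and \<epsilon>: "\<epsilon> > 0" and \<tau>: "\<tau> > 0" "\<tau>' > 0"
    and g: "\<And>w a. dot n w w = 1 \<Longrightarrow> real (card {l\<in>{..<Q}. \<bar>a + dot n (g l) w\<bar> < \<tau>}) \<le> p * Q"
    and u: "\<And>v. dot n v v = 1 \<Longrightarrow> real (card {k\<in>{..<K}. \<bar>dot n (u k) v\<bar> < \<tau>'}) \<le> K / 2"
    and KQ: "real K \<le> p * Q"
  defines "M \<equiv> \<lambda>x i j. A i j + \<epsilon> * perturbation K g u x i j"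
  defines "\<Omega> \<equiv> {..<K} \<rightarrow>\<^sub>E {..<Q}"
  shows "real (card {x\<in>\<Omega>. \<not> (\<forall>v. dot n v v = 1 \<longrightarrow> (\<epsilon> * \<tau> * \<tau>')\<^sup>2 \<le> dot n (mat_apply n (M x) v) (mat_apply n (M x) v))})
     \<le> 4 * p * card \<Omega>"
proof -
  \<comment> \<open>Isolation is tested here among the indices other than \<open>k\<close>, which
    makes the set independent of \<open>x k\<close>.\<close>
  define I' where "I' = (\<lambda>k x. {l\<in>{..<K}. l \<noteq> k \<and> (\<forall>j<K. j \<noteq> l \<longrightarrow> j \<noteq> k \<longrightarrow> (x::nat \<Rightarrow> nat) j \<noteq> x l)})"
  define M' where "M' = (\<lambda>k x i j. A i j + \<epsilon> * (\<Sum>l\<in>I' k x. g (x l) i * u l j))"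
  \<comment> \<open>\<open>M'\<close> is \<open>M\<close> without the \<open>k\<close>-th term, so \<open>w\<close> and \<open>a\<close> do not depend on \<open>x k\<close>\<close>
  define wa where "wa = (\<lambda>k x. SOME (w, a). dot n w w = 1 \<and> (\<forall>j<n. (\<Sum>i<n. M' k x i j * w i) = a * u k j))"
  define w where "w = (\<lambda>k x. fst (wa k x))"
  define a where "a = (\<lambda>k x. snd (wa k x))"
  have wa: "dot n (w k x) (w k x) = 1 \<and> (\<forall>j<n. (\<Sum>i<n. M' k x i j * w k x i) = a k x * u k j)"
    if u0: "\<exists>j<n. u k j \<noteq> 0" for k x
  proof -
    obtain w0 a0 where w0: "dot n w0 w0 = 1 \<and> (\<forall>j<n. (\<Sum>i<n. M' k x i j * w0 i) = a0 * u k j)"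
      using exists_unit_preimage_of_line[OF u0, of "M' k x"] by blast
    have "(\<lambda>(w, a). dot n w w = 1 \<and> (\<forall>j<n. (\<Sum>i<n. M' k x i j * w i) = a * u k j)) (wa k x)"
      unfolding wa_def by (rule someI[of _ "(w0, a0)"]) (use w0 in simp)
    then show ?thesis by (simp add: w_def a_def case_prod_beta)
  qed
  have I'_upd: "I' k (x(k := v)) = I' k x" for k x v
    by (auto simp: I'_def)
  have M'_upd: "M' k (x(k := v)) = M' k x" for k x v
  proof -
    have "(\<Sum>l\<in>I' k x. g ((x(k := v)) l) i * u l j) = (\<Sum>l\<in>I' k x. g (x l) i * u l j)" for i j
      by (intro sum.cong) (auto simp: I'_def)
    then show ?thesis by (simp add: M'_def I'_upd)
  qed
  have wa_upd: "w k (x(k := v)) = w k x" "a k (x(k := v)) = a k x" for k x v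
    by (simp_all add: w_def a_def wa_def M'_upd)
  \<comment> \<open>When \<open>u k\<close> vanishes, the chosen \<open>w\<close> and
    \<open>a\<close> carry no information, so nothing is asked of them. Such an index is later
    excluded because its inner product with \<open>v\<close> is 0, below
    \<open>\<tau>'\<close>.\<close>
  define bad where "bad = (\<lambda>k x. k \<notin> isolated K x \<or>
     ((\<exists>j<n. u k j \<noteq> 0) \<and> \<bar>a k x / \<epsilon> + dot n (g (x k)) (w k x)\<bar> < \<tau>))"
  have fin\<Omega>: "finite \<Omega>" unfolding \<Omega>_def by (auto intro!: finite_PiE)
  have bad: "real (card {x\<in>\<Omega>. bad k x}) \<le> 2 * p * card \<Omega>" if k: "k < K" for k
    unfolding \<Omega>_def
  proof (rule card_funcset_le_of_fibres[OF k])
    fix x :: "nat \<Rightarrow> nat" assume "x \<in> {..<K} \<rightarrow>\<^sub>E {..<Q}"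
    let ?Y = "{l\<in>{..<Q}. (\<exists>j<n. u k j \<noteq> 0) \<and> \<bar>a k x / \<epsilon> + dot n (g l) (w k x)\<bar> < \<tau>}"
    \<comment> \<open>The new value destroys the isolation of \<open>k\<close> only if
      \<open>x\<close> takes it at another index, so at most \<open>K\<close> values do.\<close>
    have "{v\<in>{..<Q}. bad k (x(k := v))} \<subseteq> x ` {..<K} \<union> ?Y"
      using k by (auto simp: bad_def wa_upd isolated_def split: if_splits)
    then have "card {v\<in>{..<Q}. bad k (x(k := v))} \<le> card (x ` {..<K} \<union> ?Y)" by (intro card_mono) auto
    also have "\<dots> \<le> card (x ` {..<K}) + card ?Y" by (rule card_Un_le)
    also have "\<dots> \<le> K + card ?Y" using card_image_le[of "{..<K}" x] by simp
    finally have "real (card {v\<in>{..<Q}. bad k (x(k := v))}) \<le> real K + real (card ?Y)" by linarith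
    moreover have "real (card ?Y) \<le> p * Q"
    proof (cases "\<exists>j<n. u k j \<noteq> 0")
      case True
      then show ?thesis using g[of "w k x" "a k x / \<epsilon>"] wa[OF True, of x] by simp
    next
      case False
      then have "?Y = {}" by auto
      then have "card ?Y = 0" by (metis card.empty)
      then show ?thesis using KQ by linarith
    qed
    ultimately show "real (card {v\<in>{..<Q}. bad k (x(k := v))}) \<le> 2 * p * Q" using KQ by linarith
  qed
  have good: "(\<epsilon> * \<tau> * \<tau>')\<^sup>2 \<le> dot n (mat_apply n (M x) v) (mat_apply n (M x) v)"
    if few: "real (card {k\<in>{..<K}. bad k x}) < K / 2" and v: "dot n v v = 1" for x v
  proof -
    \<comment> \<open>Fewer than \<open>K / 2\<close> indices are bad and at most
      \<open>K / 2\<close> have a small inner product with \<open>v\<close>, so some index is in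
      neither set.\<close>
    have "card ({k\<in>{..<K}. bad k x} \<union> {k\<in>{..<K}. \<bar>dot n (u k) v\<bar> < \<tau>'})
       \<le> card {k\<in>{..<K}. bad k x} + card {k\<in>{..<K}. \<bar>dot n (u k) v\<bar> < \<tau>'}" by (rule card_Un_le)
    then have "card ({k\<in>{..<K}. bad k x} \<union> {k\<in>{..<K}. \<bar>dot n (u k) v\<bar> < \<tau>'}) < K"
      using few u[OF v] by linarith
    then have "{k\<in>{..<K}. bad k x} \<union> {k\<in>{..<K}. \<bar>dot n (u k) v\<bar> < \<tau>'} \<noteq> {..<K}"
      by (metis card_lessThan less_irrefl)
    then have "\<exists>k<K. \<not> bad k x \<and> \<not> \<bar>dot n (u k) v\<bar> < \<tau>'" by blast
    then obtain k where k: "k < K" "\<not> bad k x" "\<tau>' \<le> \<bar>dot n (u k) v\<bar>" using not_less by blast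
    have u0: "\<exists>j<n. u k j \<noteq> 0"
    proof (rule ccontr)
      assume "\<not> ?thesis"
      then have "dot n (u k) v = 0" by (simp add: dot_def)
      then show False using k \<tau> by simp
    qed
    define W where "W = w k x"
    define c where "c = a k x + \<epsilon> * dot n (g (x k)) W"
    have W: "dot n W W = 1" "\<And>j. j < n \<Longrightarrow> (\<Sum>i<n. M' k x i j * W i) = a k x * u k j"
      using wa[OF u0] by (auto simp: W_def)
    have iso: "k \<in> isolated K x" and lo: "\<tau> \<le> \<bar>a k x / \<epsilon> + dot n (g (x k)) W\<bar>"
      using k u0 by (auto simp: bad_def W_def)
    have c: "\<epsilon> * \<tau> \<le> \<bar>c\<bar>"
    proof -
      have "c = \<epsilon> * (a k x / \<epsilon> + dot n (g (x k)) W)" using \<epsilon> by (simp add: c_def distrib_left)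
      then show ?thesis using lo \<epsilon> by (simp add: abs_mult)
    qed
    \<comment> \<open>An isolated \<open>k\<close> collides with no index, so it does not affect the
      isolation of the others.\<close>
    have ins: "isolated K x = insert k (I' k x)" "k \<notin> I' k x" "finite (I' k x)"
      using iso by (auto simp: isolated_def I'_def) metis
    have Mx: "M x i j = M' k x i j + \<epsilon> * (g (x k) i * u k j)" for i j
      unfolding M_def M'_def perturbation_def ins(1) using ins by (simp add: distrib_left)
    have "dot n W (mat_apply n (M x) v) = (\<Sum>i<n. \<Sum>j<n. M x i j * W i * v j)"
      by (simp add: dot_def mat_apply_def sum_distrib_left mult_ac)
    also have "\<dots> = (\<Sum>j<n. \<Sum>i<n. M x i j * W i * v j)" by (rule sum.swap)
    also have "\<dots> = (\<Sum>j<n. (\<Sum>i<n. M x i j * W i) * v j)" by (simp add: sum_distrib_right)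
    also have "\<dots> = (\<Sum>j<n. c * u k j * v j)"
    proof (intro sum.cong refl)
      fix j assume "j \<in> {..<n}"
      have "(\<Sum>i<n. M x i j * W i) = (\<Sum>i<n. M' k x i j * W i) + \<epsilon> * dot n (g (x k)) W * u k j"
        by (simp add: Mx dot_def sum.distrib sum_distrib_left algebra_simps)
      also have "\<dots> = c * u k j" using W(2)[of j] \<open>j \<in> {..<n}\<close> by (simp add: c_def distrib_right)
      finally show "(\<Sum>i<n. M x i j * W i) * v j = c * u k j * v j" by simp
    qed
    also have "\<dots> = c * dot n (u k) v" by (simp add: dot_def sum_distrib_left mult.assoc)
    finally have eq: "dot n W (mat_apply n (M x) v) = c * dot n (u k) v" .
    have "\<epsilon> * \<tau> * \<tau>' \<le> \<bar>c * dot n (u k) v\<bar>"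
      unfolding abs_mult using c k(3) \<epsilon> \<tau> by (intro mult_mono) auto
    then have "(\<epsilon> * \<tau> * \<tau>')\<^sup>2 \<le> \<bar>c * dot n (u k) v\<bar>\<^sup>2" using \<epsilon> \<tau> by (intro power_mono) auto
    also have "\<dots> \<le> dot n (mat_apply n (M x) v) (mat_apply n (M x) v)"
      using dot_Cauchy_Schwarz[of n W "mat_apply n (M x) v"] W(1) eq by simp
    finally show ?thesis .
  qed
  \<comment> \<open>Markov's inequality for the number of bad indices\<close>
  let ?F = "{x\<in>\<Omega>. K / 2 \<le> real (card {k\<in>{..<K}. bad k x})}"
  have "K / 2 * card ?F = (\<Sum>x\<in>?F. K / 2)" by simp
  also have "\<dots> \<le> (\<Sum>x\<in>?F. real (card {k\<in>{..<K}. bad k x}))" by (intro sum_mono) auto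
  also have "\<dots> \<le> (\<Sum>x\<in>\<Omega>. real (card {k\<in>{..<K}. bad k x}))" using fin\<Omega> by (intro sum_mono2) auto
  also have "\<dots> = (\<Sum>x\<in>\<Omega>. \<Sum>k<K. if bad k x then 1 else 0)" by (simp add: sum.If_cases Int_def)
  also have "\<dots> = (\<Sum>k<K. \<Sum>x\<in>\<Omega>. if bad k x then 1 else 0)" by (rule sum.swap)
  also have "\<dots> = (\<Sum>k<K. real (card {x\<in>\<Omega>. bad k x}))" using fin\<Omega> by (simp add: sum.If_cases Int_def)
  also have "\<dots> \<le> (\<Sum>k<K. 2 * p * card \<Omega>)" using bad by (intro sum_mono) auto
  finally have F: "real (card ?F) \<le> 4 * p * card \<Omega>" using K by (simp add: field_simps)
  have "{x\<in>\<Omega>. \<not> (\<forall>v. dot n v v = 1 \<longrightarrow> (\<epsilon> * \<tau> * \<tau>')\<^sup>2 \<le> dot n (mat_apply n (M x) v) (mat_apply n (M x) v))} \<subseteq> ?F"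
    using good not_le by blast
  then have "card {x\<in>\<Omega>. \<not> (\<forall>v. dot n v v = 1 \<longrightarrow> (\<epsilon> * \<tau> * \<tau>')\<^sup>2 \<le> dot n (mat_apply n (M x) v) (mat_apply n (M x) v))} \<le> card ?F"
    using fin\<Omega> by (intro card_mono) auto
  then show ?thesis using F by linarith
qed

section \<open>Condition numbers\<close>

lemma euclidean_norm_dot: "v \<in> carrier_vec n \<Longrightarrow> euclidean_norm v = sqrt (dot n (vec_index v) (vec_index v))"
  by (auto simp: euclidean_norm_def scalar_prod_def dot_def lessThan_atLeast0)

lemma euclidean_norm_mult_mat_vec:
  assumes M: "M \<in> carrier_mat n n" and v: "v \<in> carrier_vec n"
    and ent: "\<And>i j. i < n \<Longrightarrow> j < n \<Longrightarrow> M $$ (i, j) = F i j"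
  shows "euclidean_norm (M *\<^sub>v v) = sqrt (dot n (mat_apply n F (vec_index v)) (mat_apply n F (vec_index v)))"
proof -
  have "(M *\<^sub>v v) $ i = mat_apply n F (vec_index v) i" if "i < n" for i
    using M v that ent by (auto simp: scalar_prod_def mat_apply_def lessThan_atLeast0)
  then show ?thesis using M v by (subst euclidean_norm_dot[of _ n]) (auto intro!: dot_cong)
qed

lemma euclidean_norm_zero: "euclidean_norm (0\<^sub>v n) = 0"
  by (simp add: euclidean_norm_def)

lemma euclidean_norm_eq_0_imp:
  assumes "v \<in> carrier_vec n" "euclidean_norm v \<le> 0"
  shows "v = 0\<^sub>v n"
proof -
  have "dot n (vec_index v) (vec_index v) = 0"
    using assms euclidean_norm_dot[OF assms(1)] dot_self_nonneg[of n "vec_index v"] by simp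
  then have "\<forall>i\<in>{..<n}. v $ i * v $ i = 0"
    unfolding dot_def by (subst (asm) sum_nonneg_eq_0_iff) auto
  then show ?thesis using assms(1) by auto
qed

lemma spectral_norm_le:
  assumes "M \<in> carrier_mat n n"
    and "\<And>v. v \<in> carrier_vec n \<Longrightarrow> euclidean_norm v \<le> 1 \<Longrightarrow> euclidean_norm (M *\<^sub>v v) \<le> b"
  shows "spectral_norm M \<le> b"
  unfolding spectral_norm_def
proof (rule cSUP_least)
  show "{v \<in> carrier_vec (dim_col M). euclidean_norm v \<le> 1} \<noteq> {}"
    using euclidean_norm_zero[of "dim_col M"] by (metis (mono_tags, lifting) empty_Collect_eq zero_carrier_vec zero_le_one)
qed (use assms in auto)

text \<open>The Frobenius norm bounds all values from above, so the supremum in the definition is a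
  genuine one.\<close>

lemma euclidean_norm_le_spectral_norm:
  assumes M: "M \<in> carrier_mat n n" and v: "v \<in> carrier_vec n" "euclidean_norm v \<le> 1"
  shows "euclidean_norm (M *\<^sub>v v) \<le> spectral_norm M"
proof -
  define F where "F = (\<lambda>i j. M $$ (i, j))"
  define B where "B = sqrt (\<Sum>i<n. dot n (F i) (F i))"
  have "euclidean_norm (M *\<^sub>v v) \<le> B" if v: "v \<in> carrier_vec n" "euclidean_norm v \<le> 1" for v
  proof -
    let ?v = "vec_index v"
    have v1: "dot n ?v ?v \<le> 1" using v euclidean_norm_dot[OF v(1)] by simp
    have "dot n (mat_apply n F ?v) (mat_apply n F ?v) = (\<Sum>i<n. (dot n (F i) ?v)\<^sup>2)"
      by (simp add: dot_def mat_apply_def power2_eq_square)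
    also have "\<dots> \<le> (\<Sum>i<n. dot n (F i) (F i) * 1)"
    proof (rule sum_mono)
      fix i
      have "(dot n (F i) ?v)\<^sup>2 \<le> dot n (F i) (F i) * dot n ?v ?v" by (rule dot_Cauchy_Schwarz)
      also have "\<dots> \<le> dot n (F i) (F i) * 1" using v1 dot_self_nonneg by (intro mult_left_mono) auto
      finally show "(dot n (F i) ?v)\<^sup>2 \<le> dot n (F i) (F i) * 1" .
    qed
    finally show ?thesis
      by (subst euclidean_norm_mult_mat_vec[OF M v(1), of F]) (auto simp: F_def B_def)
  qed
  then have "bdd_above ((\<lambda>v. euclidean_norm (M *\<^sub>v v)) ` {v \<in> carrier_vec (dim_col M). euclidean_norm v \<le> 1})"
    using M by (intro bdd_aboveI2[of _ _ B]) auto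
  then show ?thesis unfolding spectral_norm_def using M v by (intro cSUP_upper) auto
qed

text \<open>The lower bound \<open>\<sigma>\<close> on the unit sphere makes \<open>M\<close>
  injective, hence invertible, and bounds the norm of the inverse by \<open>1 / \<sigma>\<close>.
  The function \<open>F\<close> links the matrix to the estimates stated for functions.\<close>

lemma condition_number_le:
  assumes M: "M \<in> carrier_mat n n" and \<sigma>: "\<sigma> > 0" and b: "0 \<le> b"
    and ent: "\<And>i j. i < n \<Longrightarrow> j < n \<Longrightarrow> M $$ (i, j) = F i j"
    and up: "\<And>v. v \<in> carrier_vec n \<Longrightarrow> euclidean_norm v \<le> 1 \<Longrightarrow> euclidean_norm (M *\<^sub>v v) \<le> b"
    and lo: "\<And>v. dot n v v = 1 \<Longrightarrow> \<sigma>\<^sup>2 \<le> dot n (mat_apply n F v) (mat_apply n F v)"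
  shows "condition_number M \<le> ereal (b / \<sigma>)"
proof -
  have lower: "\<sigma> * euclidean_norm v \<le> euclidean_norm (M *\<^sub>v v)" if v: "v \<in> carrier_vec n" for v
  proof (cases "euclidean_norm v = 0")
    case True
    then show ?thesis using dot_self_nonneg by (simp add: euclidean_norm_mult_mat_vec[OF M v ent])
  next
    case False
    let ?v = "vec_index v"
    define c where "c = sqrt (dot n ?v ?v)"
    have c: "c > 0" "euclidean_norm v = c"
      using False euclidean_norm_dot[OF v] dot_self_nonneg[of n ?v] by (auto simp: c_def less_le)
    define e where "e = (\<lambda>i. ?v i / c)"
    have "dot n e e = dot n ?v ?v / (c * c)" by (simp add: e_def dot_def sum_divide_distrib)
    then have "dot n e e = 1" using c by (simp add: c_def)
    then have "\<sigma>\<^sup>2 \<le> dot n (mat_apply n F e) (mat_apply n F e)" by (rule lo)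
    then have s: "\<sigma> \<le> sqrt (dot n (mat_apply n F e) (mat_apply n F e))" by (rule real_le_rsqrt)
    have "mat_apply n F ?v i = c * mat_apply n F e i" for i
      using c by (simp add: mat_apply_def e_def sum_distrib_left)
    then have "dot n (mat_apply n F ?v) (mat_apply n F ?v) = c\<^sup>2 * dot n (mat_apply n F e) (mat_apply n F e)"
      by (simp add: dot_def sum_distrib_left power2_eq_square mult_ac)
    then have "euclidean_norm (M *\<^sub>v v) = c * sqrt (dot n (mat_apply n F e) (mat_apply n F e))"
      using c by (simp add: euclidean_norm_mult_mat_vec[OF M v ent] real_sqrt_mult)
    then show ?thesis using s c by simp
  qed
  have "Determinant.det M \<noteq> 0"
  proof
    assume "Determinant.det M = 0"
    then obtain v where v: "v \<in> carrier_vec n" "v \<noteq> 0\<^sub>v n" "M *\<^sub>v v = 0\<^sub>v n"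
      using det_0_iff_vec_prod_zero_field[OF M] by auto
    then have "\<sigma> * euclidean_norm v \<le> 0" using lower[OF v(1)] by (simp add: euclidean_norm_zero)
    then have "euclidean_norm v \<le> 0" using \<sigma> by (simp add: mult_le_0_iff)
    then show False using euclidean_norm_eq_0_imp[OF v(1)] v(2) by simp
  qed
  then have "M \<in> Units (ring_mat TYPE(real) n ())" using M by (intro det_non_zero_imp_unit)
  then obtain M' where M': "mat_inverse M = Some M'"
    using mat_inverse(1)[OF M, of "()"] by (cases "mat_inverse M") auto
  then have inv: "M * M' = 1\<^sub>m n" "M' \<in> carrier_mat n n" using mat_inverse(2)[OF M] by auto
  have "spectral_norm M' \<le> 1 / \<sigma>"
  proof (rule spectral_norm_le[OF inv(2)])
    fix v assume v: "v \<in> carrier_vec n" "euclidean_norm v \<le> 1"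
    have "M *\<^sub>v (M' *\<^sub>v v) = v"
      using inv v M by (simp add: assoc_mult_mat_vec[symmetric, of M n n M' n])
    then have "\<sigma> * euclidean_norm (M' *\<^sub>v v) \<le> 1"
      using lower[of "M' *\<^sub>v v"] inv v by simp
    then show "euclidean_norm (M' *\<^sub>v v) \<le> 1 / \<sigma>" using \<sigma> by (simp add: field_simps)
  qed
  moreover have "0 \<le> spectral_norm M'"
  proof -
    have "0 \<le> euclidean_norm (M' *\<^sub>v 0\<^sub>v n)"
      using inv(2) by (subst euclidean_norm_dot[of _ n]) (auto simp: dot_self_nonneg)
    also have "\<dots> \<le> spectral_norm M'"
      by (rule euclidean_norm_le_spectral_norm[OF inv(2)]) (auto simp: euclidean_norm_zero)
    finally show ?thesis .
  qed
  moreover have "spectral_norm M \<le> b" by (rule spectral_norm_le[OF M up])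
  ultimately have "spectral_norm M * spectral_norm M' \<le> b * (1 / \<sigma>)" using b by (intro mult_mono) auto
  then show ?thesis by (simp add: condition_number_def M')
qed

lemma euclidean_norm_triangle:
  assumes "v \<in> carrier_vec n" "w \<in> carrier_vec n"
  shows "euclidean_norm (v + w) \<le> euclidean_norm v + euclidean_norm w"
proof -
  have "dot n (vec_index (v + w)) (vec_index (v + w)) = dot n (\<lambda>i. v $ i + w $ i) (\<lambda>i. v $ i + w $ i)"
    using assms by (intro dot_cong) auto
  then show ?thesis using dot_triangle[of n "vec_index v" "vec_index w"] assms by (simp add: euclidean_norm_dot[of _ n])
qed

section \<open>Random bits and choice of parameters\<close>

text \<open>Fair bits are uniform on \<open>2 ^ (K * q)\<close> points, as many as there are
  functions from \<open>{..<K}\<close> to \<open>{..<2 ^ q}\<close>. A bijection carries one uniform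
  law to the other.\<close>

lemma random_bits_decode:
  "\<exists>\<phi>. \<forall>P. measure (random_bits (K * q)) {\<omega>. P (\<phi> \<omega>)}
     = real (card {x \<in> {..<K} \<rightarrow>\<^sub>E {..<(2::nat) ^ q}. P x}) / real (card ({..<K} \<rightarrow>\<^sub>E {..<(2::nat) ^ q}))"
proof -
  let ?D = "PiE_dflt {..<K * q} False (\<lambda>_. UNIV :: bool set)"
  let ?\<Omega> = "{..<K} \<rightarrow>\<^sub>E {..<(2::nat) ^ q}"
  have finD: "finite ?D" by (auto intro!: finite_PiE_dflt)
  have fin\<Omega>: "finite ?\<Omega>" by (auto intro!: finite_PiE)
  have ne: "?D \<noteq> {}" "?\<Omega> \<noteq> {}" by (auto simp: PiE_eq_empty_iff lessThan_empty_iff)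
  have "card ?D = 2 ^ (K * q)" by (subst card_PiE_dflt) auto
  moreover have "card ?\<Omega> = 2 ^ (K * q)"
    by (subst card_PiE) (auto simp: power_mult[symmetric] mult.commute)
  ultimately obtain \<phi> where bij: "bij_betw \<phi> ?D ?\<Omega>"
    using finite_same_card_bij[OF finD fin\<Omega>] by auto
  have "random_bits (K * q) = measure_pmf (pmf_of_set ?D)"
    unfolding random_bits_def bernoulli_pmf_half_conv_pmf_of_set by (subst Pi_pmf_of_set) auto
  then have "measure (random_bits (K * q)) {\<omega>. P (\<phi> \<omega>)} = real (card {x \<in> ?\<Omega>. P x}) / real (card ?\<Omega>)" for P
    using measure_map_pmf[of \<phi> "pmf_of_set ?D" "{x. P x}"] map_pmf_of_set_bij_betw[OF bij ne(1) finD]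
      measure_pmf_of_set[OF ne(2) fin\<Omega>, of "{x. P x}"] by (simp add: vimage_def Int_def)
  then show ?thesis by blast
qed

text \<open>Rounding the frame sizes up to powers of two makes each selection use a whole number of
  bits, at the cost of a factor 2.\<close>

lemma exists_power_of_two_near:
  fixes x :: real
  assumes "1 \<le> x"
  shows "\<exists>a::nat. x \<le> 2 ^ a \<and> 2 ^ a \<le> 2 * x"
proof -
  define a where "a = (LEAST a. x \<le> 2 ^ a)"
  have "\<exists>a. x \<le> 2 ^ a" using real_arch_pow[of 2 x] by (auto intro: less_imp_le)
  then have 1: "x \<le> 2 ^ a" unfolding a_def by (rule LeastI_ex)
  have "2 ^ a \<le> 2 * x"
  proof (cases a)
    case 0
    then show ?thesis using assms by simp
  next
    case (Suc b)
    then have "\<not> x \<le> 2 ^ b" using not_less_Least[of b "\<lambda>a. x \<le> 2 ^ a"] by (auto simp: a_def)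
    then show ?thesis using Suc by simp
  qed
  with 1 show ?thesis by blast
qed

text \<open>Both frames are divided by their norm bounds, so the perturbation is a contraction for
  all bits and the perturbed matrix has norm at most 2. Here \<open>\<sigma>\<close> is
  \<open>\<epsilon>\<close> times the two small-ball thresholds after this scaling.\<close>

lemma perturbation_exists:
  fixes n K a b :: nat and \<epsilon> \<delta> :: real
  assumes n: "n > 0" and \<epsilon>: "0 < \<epsilon>" "\<epsilon> < 1" and \<delta>: "0 < \<delta>" "\<delta> < 1"
    and K: "K = 2^17 * n"
    and a: "2^23 * real n / \<delta>^3 \<le> 2^a" and b: "8 / \<delta> \<le> 2^b"
  defines "Q \<equiv> 2^a * 2^b :: nat"
  defines "\<sigma> \<equiv> \<epsilon> * (\<delta> / (1024 * 2^b * sqrt (512 * Q))) * (1 / (128 * sqrt (512 * K)))"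
  shows "\<exists>R. well_conditioned_oblivious_perturbation (random_bits (K * (a + b))) n R (2 / \<sigma>) \<epsilon> \<delta>"
proof -
  \<comment> \<open>The failure probability is \<open>4 * p\<close> with
    \<open>p = 2 * \<delta>'\<close>, which is \<open>\<delta>\<close> for this value.\<close>
  define \<delta>' where "\<delta>' = \<delta> / 8"
  have \<delta>': "0 < \<delta>'" "\<delta>' \<le> 1" using \<delta> by (auto simp: \<delta>'_def)
  have N: "2^14 * real n / \<delta>'^3 \<le> real (2^a)"
    using a by (simp add: \<delta>'_def power_divide field_simps)
  have J: "1 / \<delta>' \<le> real (2^b)" using b by (simp add: \<delta>'_def)
  obtain g0 where g01: "\<forall>v. (\<Sum>k<(2::nat)^a*2^b. (dot n (g0 k) v)\<^sup>2) \<le> 512 * real (2^a * 2^b) * dot n v v"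
    and g02: "\<forall>v a'. dot n v v = 1 \<longrightarrow>
      real (card {k\<in>{..<(2::nat)^a*2^b}. \<bar>a' + dot n (g0 k) v\<bar> < \<delta>'/(128 * real (2^b))}) \<le> 2 * \<delta>' * real (2^a * 2^b)"
    using exists_shift_robust_frame[OF n \<delta>' N J] by (elim exE conjE) (rule that; assumption)
  \<comment> \<open>The second frame only needs half of its inner products to be large, so its
    parameter is \<open>1/2\<close> and \<open>K\<close> is linear in \<open>n\<close>.\<close>
  have NK: "2^14 * real n / (1/2)^3 \<le> real K" by (simp add: K power_divide)
  have half: "0 < (1/2::real)" "(1/2::real) \<le> 1" by simp_all
  obtain u0 where u01: "\<forall>v. (\<Sum>k<K. (dot n (u0 k) v)\<^sup>2) \<le> 512 * real K * dot n v v"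
    and u02: "\<forall>v. dot n v v = 1 \<longrightarrow> real (card {k\<in>{..<K}. \<bar>dot n (u0 k) v\<bar> < 1/2/64}) \<le> 1/2 * real K"
    using exists_robust_frame[OF n half NK] by (elim exE conjE) (rule that; assumption)
  have K0: "K > 0" using n by (simp add: K)
  have Q0: "Q > 0" by (simp add: Q_def)
  define sg where "sg = sqrt (512 * real Q)"
  define su where "su = sqrt (512 * real K)"
  have sg: "sg > 0" "sg\<^sup>2 = 512 * real Q" using Q0 by (auto simp: sg_def)
  have su: "su > 0" "su\<^sup>2 = 512 * real K" using K0 by (auto simp: su_def)
  define g where "g = (\<lambda>k i. 1 / sg * g0 k i)"
  define u where "u = (\<lambda>k i. 1 / su * u0 k i)"
  have dg: "dot n (g k) v = dot n (g0 k) v / sg" for k v by (simp only: g_def dot_scale) simp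
  have du: "dot n (u k) v = dot n (u0 k) v / su" for k v by (simp only: u_def dot_scale) simp
  have g1: "(\<Sum>l<Q. (dot n (g l) v)\<^sup>2) \<le> dot n v v" for v
    using g01[rule_format, of v] sg Q0
    by (simp add: dg power_divide sum_divide_distrib[symmetric] divide_le_eq Q_def[symmetric] mult.commute)
  have u1: "(\<Sum>k<K. (dot n (u k) v)\<^sup>2) \<le> dot n v v" for v
    using u01[rule_format, of v] su K0
    by (simp add: du power_divide sum_divide_distrib[symmetric] divide_le_eq mult.commute)
  define \<tau> where "\<tau> = \<delta> / (1024 * 2^b * sg)"
  define \<tau>' where "\<tau>' = 1 / (128 * su)"
  have \<tau>: "\<tau> > 0" "\<tau>' > 0" using \<delta> sg su by (auto simp: \<tau>_def \<tau>'_def)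
  have \<sigma>: "\<sigma> = \<epsilon> * \<tau> * \<tau>'" by (simp add: \<sigma>_def \<tau>_def \<tau>'_def sg_def su_def)
  have \<sigma>0: "\<sigma> > 0" using \<epsilon> \<tau> by (simp add: \<sigma>)
  have scale: "\<bar>x / s\<bar> < t / s \<longleftrightarrow> \<bar>x\<bar> < t" if "0 < s" for x t s :: real
    using that by (simp add: abs_divide divide_less_cancel)
  have g2: "real (card {l\<in>{..<Q}. \<bar>a' + dot n (g l) w\<bar> < \<tau>}) \<le> \<delta>/4 * Q" if w: "dot n w w = 1" for w a'
  proof -
    have "\<bar>a' + dot n (g l) w\<bar> < \<tau> \<longleftrightarrow> \<bar>a' * sg + dot n (g0 l) w\<bar> < \<delta>'/(128 * real (2^b))" for l
    proof -
      have "a' + dot n (g l) w = (a' * sg + dot n (g0 l) w) / sg" using sg by (simp add: dg field_simps)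
      moreover have "\<tau> = \<delta>'/(128 * real (2^b)) / sg" by (simp add: \<tau>_def \<delta>'_def)
      ultimately show ?thesis by (simp only: scale[OF sg(1)])
    qed
    then show ?thesis using g02[rule_format, OF w, of "a' * sg"] by (simp add: Q_def \<delta>'_def)
  qed
  have u2: "real (card {k\<in>{..<K}. \<bar>dot n (u k) v\<bar> < \<tau>'}) \<le> K / 2" if v: "dot n v v = 1" for v
  proof -
    have "\<bar>dot n (u k) v\<bar> < \<tau>' \<longleftrightarrow> \<bar>dot n (u0 k) v\<bar> < 1/2/64" for k
    proof -
      have "\<tau>' = 1/2/64 / su" by (simp add: \<tau>'_def)
      then show ?thesis by (simp only: du scale[OF su(1)])
    qed
    then show ?thesis using u02[rule_format, OF v] by simp
  qed
  have KQ: "real K \<le> \<delta>/4 * Q"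
  proof -
    have "2^23 * real n / \<delta>^3 * (8 / \<delta>) \<le> real Q"
      unfolding Q_def of_nat_mult of_nat_power of_nat_numeral using a b \<delta> by (intro mult_mono) auto
    then have "\<delta>/4 * (2^23 * real n / \<delta>^3 * (8 / \<delta>)) \<le> \<delta>/4 * Q" using \<delta> by (intro mult_left_mono) auto
    moreover have "\<delta>/4 * (2^23 * real n / \<delta>^3 * (8 / \<delta>)) = 2^24 * real n / \<delta>^3"
      using \<delta> by (simp add: field_simps)
    moreover have "\<delta>^3 \<le> 1" using \<delta> by (simp add: power_le_one)
    then have "2^17 * real n \<le> 2^24 * real n / \<delta>^3"
      using \<delta> mult_left_mono[of "\<delta>^3" 1 "2^17 * real n"] by (simp add: pos_le_divide_eq)
    ultimately show ?thesis by (simp add: K)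
  qed
  obtain \<phi> where \<phi>: "\<And>P. measure (random_bits (K * (a + b))) {\<omega>. P (\<phi> \<omega>)}
     = real (card {x \<in> {..<K} \<rightarrow>\<^sub>E {..<(2::nat) ^ (a + b)}. P x}) / real (card ({..<K} \<rightarrow>\<^sub>E {..<(2::nat) ^ (a + b)}))"
    using random_bits_decode[of K "a + b"] by blast
  define \<Omega> where "\<Omega> = {..<K} \<rightarrow>\<^sub>E {..<Q}"
  have \<phi>: "measure (random_bits (K * (a + b))) {\<omega>. P (\<phi> \<omega>)} = real (card {x \<in> \<Omega>. P x}) / real (card \<Omega>)" for P
    using \<phi> by (simp add: \<Omega>_def Q_def power_add)
  have fin: "finite \<Omega>" unfolding \<Omega>_def by (auto intro!: finite_PiE)
  have "\<Omega> \<noteq> {}" using Q0 by (auto simp: \<Omega>_def PiE_eq_empty_iff lessThan_empty_iff)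
  then have c0: "card \<Omega> > 0" using fin by (simp add: card_gt_0_iff)
  define S where "S = (\<lambda>x. mat n n (\<lambda>(i, j). perturbation K g u x i j))"
  have S: "S x \<in> carrier_mat n n" for x by (simp add: S_def)
  have Sv: "euclidean_norm (S x *\<^sub>v v) \<le> 1"
    if "x \<in> \<Omega>" "v \<in> carrier_vec n" "euclidean_norm v \<le> 1" for x v
  proof -
    have "euclidean_norm (S x *\<^sub>v v) \<le> euclidean_norm v"
      using perturbation_contraction[OF g1 u1, where x = x and v = "vec_index v"] that
      by (subst euclidean_norm_mult_mat_vec[OF S that(2), of _ "perturbation K g u x"])
         (auto simp: S_def \<Omega>_def euclidean_norm_dot[of _ n])
    then show ?thesis using that by simp
  qed
  have main: "1 - \<delta> \<le> measure (random_bits (K * (a + b)))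
     {\<omega>. condition_number (A + \<epsilon> \<cdot>\<^sub>m S (\<phi> \<omega>)) \<le> ereal (2 / \<sigma>) \<and> spectral_norm (S (\<phi> \<omega>)) \<le> 1}"
    if A: "A \<in> carrier_mat n n" "spectral_norm A = 1" for A
  proof -
    define F where "F = (\<lambda>x i j. A $$ (i, j) + \<epsilon> * perturbation K g u x i j)"
    define P where "P = (\<lambda>x. condition_number (A + \<epsilon> \<cdot>\<^sub>m S x) \<le> ereal (2 / \<sigma>) \<and> spectral_norm (S x) \<le> 1)"
    let ?B = "{x\<in>\<Omega>. \<not> (\<forall>v. dot n v v = 1 \<longrightarrow> \<sigma>\<^sup>2 \<le> dot n (mat_apply n (F x) v) (mat_apply n (F x) v))}"
    have B: "real (card ?B) \<le> 4 * (\<delta>/4) * card \<Omega>"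
      unfolding \<Omega>_def F_def \<sigma>
      by (rule card_ill_conditioned[OF K0 \<epsilon>(1) \<tau> g2 u2 KQ])
    have "P x" if x: "x \<in> \<Omega> - ?B" for x
    proof -
      have lo: "\<And>v. dot n v v = 1 \<Longrightarrow> \<sigma>\<^sup>2 \<le> dot n (mat_apply n (F x) v) (mat_apply n (F x) v)"
        using x by auto
      have "condition_number (A + \<epsilon> \<cdot>\<^sub>m S x) \<le> ereal (2 / \<sigma>)"
      proof (rule condition_number_le[OF _ \<sigma>0 _ _ _ lo])
        show "A + \<epsilon> \<cdot>\<^sub>m S x \<in> carrier_mat n n" using A S by simp
        show "(A + \<epsilon> \<cdot>\<^sub>m S x) $$ (i, j) = F x i j" if "i < n" "j < n" for i j
          using that A S by (simp add: F_def S_def)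
        fix v assume v: "v \<in> carrier_vec n" "euclidean_norm v \<le> 1"
        have "(A + \<epsilon> \<cdot>\<^sub>m S x) *\<^sub>v v = A *\<^sub>v v + \<epsilon> \<cdot>\<^sub>v (S x *\<^sub>v v)"
        proof -
          have "(\<epsilon> \<cdot>\<^sub>m S x) *\<^sub>v v = \<epsilon> \<cdot>\<^sub>v (S x *\<^sub>v v)" using S[of x] v(1) by (intro eq_vecI) auto
          then show ?thesis using A(1) S[of x] v(1) by (simp add: add_mult_distrib_mat_vec[of _ n n])
        qed
        moreover have "euclidean_norm (A *\<^sub>v v + \<epsilon> \<cdot>\<^sub>v (S x *\<^sub>v v)) \<le>
            euclidean_norm (A *\<^sub>v v) + euclidean_norm (\<epsilon> \<cdot>\<^sub>v (S x *\<^sub>v v))"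
          using A(1) S[of x] v by (intro euclidean_norm_triangle[of _ n]) auto
        moreover have "euclidean_norm (A *\<^sub>v v) \<le> 1"
          using euclidean_norm_le_spectral_norm[OF A(1) v] A(2) by simp
        moreover have "euclidean_norm (\<epsilon> \<cdot>\<^sub>v (S x *\<^sub>v v)) \<le> 1"
        proof -
          have "euclidean_norm (\<epsilon> \<cdot>\<^sub>v (S x *\<^sub>v v)) = \<epsilon> * euclidean_norm (S x *\<^sub>v v)"
            using \<epsilon> by (simp add: euclidean_norm_def real_sqrt_mult)
          also have "\<dots> \<le> 1 * 1"
            using \<epsilon> Sv[of x v] x v S[of x]
            by (intro mult_mono) (auto simp: euclidean_norm_dot[of _ n] dot_self_nonneg)
          finally show ?thesis by simp
        qed
        ultimately show "euclidean_norm ((A + \<epsilon> \<cdot>\<^sub>m S x) *\<^sub>v v) \<le> 2" by simp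
      qed simp
      moreover have "spectral_norm (S x) \<le> 1" using x by (intro spectral_norm_le[OF S] Sv) auto
      ultimately show ?thesis by (simp add: P_def)
    qed
    then have "\<Omega> - ?B \<subseteq> {x\<in>\<Omega>. P x}" by blast
    then have "card (\<Omega> - ?B) \<le> card {x\<in>\<Omega>. P x}" using fin by (intro card_mono) auto
    moreover have "real (card (\<Omega> - ?B)) = real (card \<Omega>) - real (card ?B)"
    proof -
      have "?B \<subseteq> \<Omega>" by (rule Collect_subset)
      then show ?thesis using fin card_Diff_subset[of ?B \<Omega>] card_mono[of \<Omega> ?B]
        by (simp add: finite_subset of_nat_diff)
    qed
    ultimately have "(1 - \<delta>) * card \<Omega> \<le> real (card {x\<in>\<Omega>. P x})"
      using B by (simp add: algebra_simps)
    then have "1 - \<delta> \<le> real (card {x\<in>\<Omega>. P x}) / card \<Omega>" using c0 by (simp add: pos_le_divide_eq)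
    then show ?thesis using \<phi>[of P] by (simp add: P_def)
  qed
  have "well_conditioned_oblivious_perturbation (random_bits (K * (a + b))) n (\<lambda>\<omega>. S (\<phi> \<omega>)) (2 / \<sigma>) \<epsilon> \<delta>"
    unfolding well_conditioned_oblivious_perturbation_def random_matrix_def
  proof (intro conjI ballI impI allI)
    show "prob_space (random_bits (K * (a + b)))"
      unfolding random_bits_def by (rule prob_space_measure_pmf)
    show "(\<lambda>\<omega>. S (\<phi> \<omega>) $$ (i, j)) \<in> borel_measurable (random_bits (K * (a + b)))" for i j
      by (simp add: random_bits_def)
    show "1 - \<delta> \<le> measure (random_bits (K * (a + b))) {\<omega> \<in> space (random_bits (K * (a + b))).
        condition_number (A + \<epsilon> \<cdot>\<^sub>m S (\<phi> \<omega>)) \<le> ereal (2 / \<sigma>) \<and> spectral_norm (S (\<phi> \<omega>)) \<le> 1}"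
      if "A \<in> carrier_mat n n" "spectral_norm A = 1" for A
      using main[OF that] by (simp add: random_bits_def)
  qed (rule S)
  then show ?thesis by blast
qed

text \<open>A one-by-one matrix of norm 1 is 1 or -1, with condition number 1, so it can be left
  unperturbed and no bits are spent.\<close>

lemma perturbation_exists_dimension_one:
  fixes \<epsilon> \<delta> :: real
  assumes \<delta>: "0 < \<delta>"
  shows "well_conditioned_oblivious_perturbation (random_bits 0) 1 (\<lambda>_. 0\<^sub>m 1 1) 1 \<epsilon> \<delta>"
proof -
  have "condition_number (A + \<epsilon> \<cdot>\<^sub>m 0\<^sub>m 1 1) \<le> ereal 1"
    if A: "A \<in> carrier_mat 1 1" "spectral_norm A = 1" for A
  proof -
    define F where "F = (\<lambda>i j. A $$ (i, j))"
    have nv: "euclidean_norm (A *\<^sub>v v) = \<bar>A $$ (0, 0)\<bar> * euclidean_norm v" if v: "v \<in> carrier_vec 1" for v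
      using euclidean_norm_mult_mat_vec[OF A(1) v, of F] euclidean_norm_dot[OF v]
      by (simp add: F_def dot_def mat_apply_def abs_mult)
    have "spectral_norm A \<le> \<bar>A $$ (0, 0)\<bar>"
      by (rule spectral_norm_le[OF A(1)]) (simp add: nv mult_left_le)
    then have "1 \<le> \<bar>A $$ (0, 0)\<bar>" using A(2) by simp
    then have ge: "1 \<le> (A $$ (0, 0))\<^sup>2" using one_le_power[of "\<bar>A $$ (0, 0)\<bar>" 2] by simp
    have "condition_number A \<le> ereal (1 / 1)"
    proof (rule condition_number_le[OF A(1), where F = F])
      show "1\<^sup>2 \<le> dot 1 (mat_apply 1 F v) (mat_apply 1 F v)" if "dot 1 v v = 1" for v
      proof -
        have "dot 1 (mat_apply 1 F v) (mat_apply 1 F v) = (A $$ (0, 0))\<^sup>2 * dot 1 v v"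
          by (simp add: dot_def mat_apply_def F_def power2_eq_square mult_ac)
        then show ?thesis using ge that by simp
      qed
      show "euclidean_norm (A *\<^sub>v v) \<le> 1" if "v \<in> carrier_vec 1" "euclidean_norm v \<le> 1" for v
        using euclidean_norm_le_spectral_norm[OF A(1) that] A(2) by simp
    qed (auto simp: F_def)
    moreover have "A + \<epsilon> \<cdot>\<^sub>m 0\<^sub>m 1 1 = A" using A(1) by auto
    ultimately show ?thesis by simp
  qed
  moreover have "spectral_norm (0\<^sub>m 1 1) \<le> 1"
  proof (rule spectral_norm_le[of _ 1])
    fix v :: "real Matrix.vec" assume "v \<in> carrier_vec 1"
    then have "0\<^sub>m 1 1 *\<^sub>v v = 0\<^sub>v 1" by (intro eq_vecI) auto
    then show "euclidean_norm (0\<^sub>m 1 1 *\<^sub>v v) \<le> 1" using euclidean_norm_zero[of 1] by simp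
  qed simp
  moreover have "measure (random_bits 0) UNIV = 1"
    using measure_pmf.prob_space by (simp add: random_bits_def)
  ultimately show ?thesis
    using \<delta> unfolding well_conditioned_oblivious_perturbation_def random_matrix_def
    by (auto simp: random_bits_def prob_space_measure_pmf)
qed

theorem theorem1p2:
  shows "\<exists>C>0::real. \<forall>n::nat. \<forall>\<epsilon> \<delta> :: real.
    n \<ge> 1 \<longrightarrow> \<epsilon> \<in> {0<..<1} \<longrightarrow> \<delta> \<in> {0<..<1} \<longrightarrow>
    (\<exists>(m::nat) (R :: (nat \<Rightarrow> bool) \<Rightarrow> real mat) (\<kappa>::real).
       real m \<le> C * real n * ln (real n) * \<delta> powr (- C) \<and>
       \<kappa> \<le> C * real n * (\<epsilon> * \<delta>) powr (- C) \<and>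
       well_conditioned_oblivious_perturbation (random_bits m) n R \<kappa> \<epsilon> \<delta>)"
proof -
  \<comment> \<open>The factor comes from the bound on \<open>\<kappa>\<close>, where
    \<open>2^18\<close>, \<open>2^4\<close> and \<open>2^32\<close> are multiplied; the bits need
    only \<open>2^23\<close>. As an exponent, \<open>C\<close> must be at least 4.\<close>
  define C :: real where "C = 2^54"
  have C4: "4 \<le> C" by (simp add: C_def)
  show ?thesis
  proof (intro exI[of _ C] conjI allI impI)
    show "0 < C" using C4 by simp
  next
    fix n :: nat and \<epsilon> \<delta> :: real
    assume n: "n \<ge> 1" and "\<epsilon> \<in> {0<..<1}" and "\<delta> \<in> {0<..<1}"
    then have \<epsilon>: "0 < \<epsilon>" "\<epsilon> < 1" and \<delta>: "0 < \<delta>" "\<delta> < 1" by auto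
    have ed: "0 < \<epsilon> * \<delta>" "\<epsilon> * \<delta> \<le> 1" using \<epsilon> \<delta> by (auto intro: mult_le_one)
    show "\<exists>m R \<kappa>. real m \<le> C * real n * ln (real n) * \<delta> powr (- C) \<and>
         \<kappa> \<le> C * real n * (\<epsilon> * \<delta>) powr (- C) \<and>
         well_conditioned_oblivious_perturbation (random_bits m) n R \<kappa> \<epsilon> \<delta>"
    \<comment> \<open>For \<open>n = 1\<close> the factor \<open>ln n\<close> vanishes and no bits
      are available. For larger \<open>n\<close> it is at least \<open>2/3\<close> and absorbs the
      additive constants.\<close>
    proof (cases "n = 1")
      case True
      have "1 = (\<epsilon> * \<delta>) powr 0" using \<epsilon> \<delta> by simp
      also have "\<dots> \<le> (\<epsilon> * \<delta>) powr (- C)" using ed C4 by (intro powr_mono') auto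
      finally have "1 * 1 \<le> C * (\<epsilon> * \<delta>) powr (- C)" using C4 by (intro mult_mono) auto
      then have "1 \<le> C * real n * (\<epsilon> * \<delta>) powr (- C)" using True by simp
      then show ?thesis using True perturbation_exists_dimension_one[OF \<delta>(1), of \<epsilon>]
        by (intro exI[of _ 0] exI[of _ "\<lambda>_. 0\<^sub>m 1 1"] exI[of _ 1]) simp
    next
      case False
      then have n2: "n \<ge> 2" using n by simp
      have d3: "\<delta>^3 \<le> 1" using \<delta> by (simp add: power_le_one)
      have "1 \<le> 2^23 * real n / \<delta>^3"
        using \<delta> n d3 by (simp add: pos_le_divide_eq)
      then obtain a where a: "2^23 * real n / \<delta>^3 \<le> 2^a" "2^a \<le> 2 * (2^23 * real n / \<delta>^3)"
        using exists_power_of_two_near by blast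
      have "1 \<le> 8 / \<delta>" using \<delta> by simp
      then obtain b where b: "8 / \<delta> \<le> 2^b" "2^b \<le> 2 * (8 / \<delta>)"
        using exists_power_of_two_near by blast
      define K where "K = 2^17 * n"
      define Q where "Q = (2^a * 2^b :: nat)"
      define \<sigma> where "\<sigma> = \<epsilon> * (\<delta> / (1024 * 2^b * sqrt (512 * Q))) * (1 / (128 * sqrt (512 * K)))"
      obtain R where R: "well_conditioned_oblivious_perturbation (random_bits (K * (a + b))) n R (2 / \<sigma>) \<epsilon> \<delta>"
        using perturbation_exists[OF _ \<epsilon> \<delta> K_def a(1) b(1)] n unfolding \<sigma>_def Q_def by auto
      have Qreal: "real Q = 2^a * 2^b" by (simp add: Q_def)
      have Q: "real Q \<le> 2^28 * real n / \<delta>^4"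
      proof -
        have "real Q \<le> 2 * (2^23 * real n / \<delta>^3) * (2 * (8 / \<delta>))"
          unfolding Qreal using a(2) b(2) \<delta> by (intro mult_mono) auto
        also have "\<dots> = 2^28 * real n / \<delta>^4" using \<delta> by (simp add: field_simps eval_nat_numeral)
        finally show ?thesis .
      qed
      have bits: "real (K * (a + b)) \<le> C * real n * ln (real n) * \<delta> powr (- C)"
      proof -
        have ln2: "2/3 \<le> ln (2::real)" by (rule ln2_ge_two_thirds)
        have lnn: "ln 2 \<le> ln (real n)" using n2 by simp
        have inv: "1 \<le> 1 / \<delta>" using \<delta> by simp
        have "real (a + b) * ln 2 = ln (real Q)"
          by (simp add: Qreal ln_mult ln_realpow algebra_simps)
        also have "\<dots> \<le> ln (2^28 * real n / \<delta>^4)" using Q by (subst ln_le_cancel_iff) (use n \<delta> in \<open>auto simp: Qreal\<close>)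
        also have "\<dots> = 28 * ln 2 + ln (real n) + 4 * ln (1 / \<delta>)"
          using n \<delta> ln_realpow[of 2 28] by (simp add: ln_mult ln_div ln_realpow)
        also have "ln (1 / \<delta>) \<le> 1 / \<delta>" using ln_le_minus_one[of "1 / \<delta>"] \<delta> by simp
        \<comment> \<open>The three terms contribute 28, 1 and 6: \<open>ln 2 \<le> ln n\<close> and
          \<open>1 \<le> 1 / \<delta>\<close> handle the first two, while
          \<open>ln n \<ge> 2/3\<close> gives
          \<open>4 / \<delta> \<le> 6 * ln n / \<delta>\<close>.\<close>
        also have "28 * ln 2 + ln (real n) + 4 * (1 / \<delta>) \<le> 35 * (ln (real n) * (1 / \<delta>))"
        proof -
          have "ln (real n) * 1 \<le> ln (real n) * (1 / \<delta>)" using lnn ln2 inv by (intro mult_left_mono) linarith+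
          moreover have "2/3 * (1 / \<delta>) \<le> ln (real n) * (1 / \<delta>)" using lnn ln2 inv by (intro mult_right_mono) linarith+
          ultimately show ?thesis using lnn by linarith
        qed
        finally have "real (a + b) * ln 2 \<le> 35 * (ln (real n) * (1 / \<delta>))" by simp
        moreover have "real (a + b) * (2/3) \<le> real (a + b) * ln 2" using ln2 by (intro mult_left_mono) auto
        moreover have "0 \<le> ln (real n) * (1 / \<delta>)" using lnn ln2 inv by (intro mult_nonneg_nonneg) linarith+
        moreover define X where "X = ln (real n) * (1 / \<delta>)"
        ultimately have "real (a + b) * (2/3) \<le> 35 * X" "0 \<le> X" by (blast intro: order_trans)+
        moreover have "Y \<le> 64 * X" if "Y * (2/3) \<le> 35 * X" "0 \<le> X" for Y :: real using that by simp
        ultimately have ab: "real (a + b) \<le> 64 * (ln (real n) * (1 / \<delta>))" unfolding X_def by blast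
        have "1 / \<delta> \<le> \<delta> powr (- C)" using powr_mono'[of "- C" "-1" \<delta>] \<delta> C4 by (simp add: powr_minus_divide)
        then have "64 * (ln (real n) * (1 / \<delta>)) \<le> 64 * (ln (real n) * \<delta> powr (- C))"
          using lnn ln2 by (intro mult_left_mono) auto
        with ab have "real (a + b) \<le> 64 * (ln (real n) * \<delta> powr (- C))" by linarith
        then have "real K * real (a + b) \<le> (2^17 * real n) * (64 * (ln (real n) * \<delta> powr (- C)))"
          unfolding K_def by (intro mult_mono) auto
        also have "\<dots> = 2^23 * (real n * ln (real n) * \<delta> powr (- C))" by simp
        also have "\<dots> \<le> C * (real n * ln (real n) * \<delta> powr (- C))"
          using lnn ln2 by (intro mult_right_mono) (auto simp: C_def)
        finally show ?thesis by (simp add: mult.assoc)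
      qed
      have kappa: "2 / \<sigma> \<le> C * real n * (\<epsilon> * \<delta>) powr (- C)"
      proof -
        have s: "sqrt (512 * Q) * sqrt (512 * K) \<le> 2^32 * real n / \<delta>^2"
        proof -
          have "sqrt (512 * Q) * sqrt (512 * K) = sqrt (2^18 * (real Q * real K))"
            by (simp add: real_sqrt_mult[symmetric])
          also have "\<dots> \<le> sqrt ((2^32 * real n / \<delta>^2)\<^sup>2)"
          proof (rule real_sqrt_le_mono)
            have "real Q * real K \<le> (2^28 * real n / \<delta>^4) * (2^17 * real n)"
              using Q \<delta> by (intro mult_mono) (auto simp: K_def)
            then have "2^18 * (real Q * real K) \<le> 2^18 * ((2^28 * real n / \<delta>^4) * (2^17 * real n))" by simp
            also have "\<dots> = 2^63 * (real n / \<delta>\<^sup>2)\<^sup>2"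
              by (simp add: power_divide power2_eq_square[of "real n"] flip: power_mult)
            \<comment> \<open>Raising the exponent to an even number produces a perfect
              square.\<close>
            also have "\<dots> \<le> 2^64 * (real n / \<delta>\<^sup>2)\<^sup>2" by (intro mult_right_mono) auto
            also have "\<dots> = (2^32 * real n / \<delta>^2)\<^sup>2" by (simp add: power_divide power_mult_distrib)
            finally show "2^18 * (real Q * real K) \<le> (2^32 * real n / \<delta>^2)\<^sup>2" .
          qed
          also have "\<dots> = 2^32 * real n / \<delta>^2" using \<delta> by simp
          finally show ?thesis .
        qed
        have "2 / \<sigma> = 2^18 / (\<epsilon> * \<delta>) * (2^b * (sqrt (512 * Q) * sqrt (512 * K)))"
          unfolding \<sigma>_def by (simp add: divide_simps)
        also have "\<dots> \<le> 2^18 / (\<epsilon> * \<delta>) * (2 * (8 / \<delta>) * (2^32 * real n / \<delta>^2))"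
          using s b \<epsilon> \<delta> by (intro mult_left_mono mult_mono) auto
        also have "\<dots> = C * real n * (1 / (\<epsilon> * \<delta>^4))"
          using \<epsilon> \<delta> by (simp add: C_def field_simps power2_eq_square eval_nat_numeral)
        also have "1 / (\<epsilon> * \<delta>^4) \<le> (\<epsilon> * \<delta>) powr (- C)"
        proof -
          have "\<epsilon>^4 \<le> \<epsilon>^1" using \<epsilon> by (intro power_decreasing) auto
          then have "(\<epsilon> * \<delta>)^4 \<le> \<epsilon> * \<delta>^4" using \<delta> by (simp add: power_mult_distrib)
          then have "1 / (\<epsilon> * \<delta>^4) \<le> 1 / (\<epsilon> * \<delta>)^4" using \<epsilon> \<delta> by (intro divide_left_mono) auto
          also have "\<dots> = (\<epsilon> * \<delta>) powr (-4)" using ed by (simp add: powr_minus_divide powr_numeral)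
          also have "\<dots> \<le> (\<epsilon> * \<delta>) powr (- C)" using ed C4 by (intro powr_mono') auto
          finally show ?thesis .
        qed
        finally show ?thesis using C4 by (simp add: mult_left_mono)
      qed
      show ?thesis using bits kappa R by blast
    qed
  qed
qed

end
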